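(* Let $n\in\mathbb{N}$ and $K\subseteq\{1,\dots,n-1\}$. Then the following are equivalent: (i) $\mathrm{Fl}_{K;n}^{>0}=\mathrm{Fl}_{K;n}^{\Delta>0}$; (ii) $\mathrm{Fl}_{K;n}^{\ge 0}=\mathrm{Fl}_{K;n}^{\Delta\ge 0}$; (iii) the set $K$ consists of consecutive integers.
   Context: For $K=\{k_1<\dots<k_l\}\subseteq\{1,\dots,n-1\}$, the partial flag variety $\mathrm{Fl}_{K;n}(\mathbb{R})$ is the set of tuples $V=(V_{k_1},\dots,V_{k_l})$ of subspaces $V_{k_1}\subset\dots\subset V_{k_l}\subset\mathbb{R}^n$ with $\dim V_{k_i}=k_i$, with its usual (Euclidean) topology; equivalently $\mathrm{GL}_n(\mathbb{R})/P$ for the block upper-triangular parabolic $P$, where $g\in\mathrm{GL}_n(\mathbb{R})$ represents the flag with $V_k$ the span of the first $k$ columns of $g$. A real matrix $A$ with $n$ rows and at least $k_l$ columns represents $V$ if $V_k$ is the span of the first $k$ columns of $A$ for each $k\in K$. For $k\in K$ and a $k$-subset $I\subseteq[n]$, the Plücker coordinate $\Delta_I(V)$ is the determinant of the submatrix of $A$ in rows $I$ and columns $1,\dots,k$ (defined up to a nonzero scalar depending on $k$). A real matrix is totally positive if all its minors are positive; $\mathrm{GL}_n^{>0}$ denotes the totally positive invertible $n\times n$ matrices. The totally positive part $\mathrm{Fl}_{K;n}^{>0}$ is the set of flags representable by a matrix in $\mathrm{GL}_n^{>0}$, and the totally nonnegative part $\mathrm{Fl}_{K;n}^{\ge0}$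 is its closure. The Plücker-positive part $\mathrm{Fl}_{K;n}^{\Delta>0}$ (resp. Plücker-nonnegative part $\mathrm{Fl}_{K;n}^{\Delta\ge0}$) is the set of flags representable by a matrix $A$ all of whose minors in rows $I$ and columns $1,\dots,k$ are positive (resp. nonnegative), for all $k\in K$ and all $k$-subsets $I\subseteq[n]$. *)

theory Defs
  imports
    "HOL-Analysis.Function_Topology"
    "Jordan_Normal_Form.DL_Rank"
    "Jordan_Normal_Form.DL_Submatrix"
begin

text \<open>
  Rows and columns of matrices are indexed from \<open>0\<close>, so the index set \<open>[n]\<close> becomes
  \<open>{..<n}\<close> and ``columns \<open>1, \<dots>, k\<close>'' becomes \<open>{..<k}\<close>. The set \<open>K\<close> of dimensions is not shifted.
\<close>

definition Rspace :: "nat \<Rightarrow> (real, real vec) module" where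
  "Rspace n = module_vec TYPE(real) n"

definition col_span :: "nat \<Rightarrow> real mat \<Rightarrow> nat \<Rightarrow> real vec set" where
  "col_span n A k = LinearCombinations.module.span class_ring (Rspace n) (col A ` {..<k})"

text \<open>
  A flag is a family indexed by \<open>K\<close>; as a total function on \<^typ>\<open>nat\<close> it is required to be
  \<^const>\<open>undefined\<close> outside \<open>K\<close>, so that equal flags are equal as functions.
\<close>

definition flags :: "nat set \<Rightarrow> nat \<Rightarrow> (nat \<Rightarrow> real vec set) set" where
  "flags K n =
     {V \<in> extensional K.
        (\<forall>k\<in>K. VectorSpace.subspace class_ring (V k) (Rspace n) \<and>
               vectorspace.dim class_ring (Rspace n\<lparr>carrier := V k\<rparr>) = k) \<and>
        (\<forall>j\<in>K. \<forall>k\<in>K. j < k \<longrightarrow> V j \<subset> V k)}"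

definition represents :: "nat set \<Rightarrow> nat \<Rightarrow> real mat \<Rightarrow> (nat \<Rightarrow> real vec set) \<Rightarrow> bool" where
  "represents K n A V \<longleftrightarrow>
     dim_row A = n \<and> (\<forall>k\<in>K. k \<le> dim_col A \<and> V k = col_span n A k)"

definition GL :: "nat \<Rightarrow> real mat set" where
  "GL n = {g \<in> carrier_mat n n. invertible_mat g}"

definition flag_of :: "nat set \<Rightarrow> nat \<Rightarrow> real mat \<Rightarrow> nat \<Rightarrow> real vec set" where
  "flag_of K n g = (\<lambda>k\<in>K. col_span n g k)"

text \<open>The Euclidean topology on matrices is the product topology on the tuple of entries.\<close>

definition mat_topology :: "nat \<Rightarrow> nat \<Rightarrow> real mat topology" where
  "mat_topology m n =
     pullback_topology (carrier_mat m n)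
       (\<lambda>A. restrict (($$) A) ({..<m} \<times> {..<n}))
       (product_topology (\<lambda>_. euclideanreal) ({..<m} \<times> {..<n}))"

definition GL_topology :: "nat \<Rightarrow> real mat topology" where
  "GL_topology n = subtopology (mat_topology n n) (GL n)"

text \<open>
  The flag variety carries the quotient topology of \<open>GL n\<close> by the block upper-triangular
  parabolic subgroup, whose left cosets are the fibres of \<open>flag_of K n\<close>.
\<close>

definition flag_topology :: "nat set \<Rightarrow> nat \<Rightarrow> (nat \<Rightarrow> real vec set) topology" where
  "flag_topology K n =
     topology (\<lambda>U. U \<subseteq> flags K n \<and> openin (GL_topology n) {g \<in> GL n. flag_of K n g \<in> U})"

lemma istopology_flag:
  "istopology (\<lambda>U. U \<subseteq> flags K n \<and> openin (GL_topology n) {g \<in> GL n. flag_of K n g \<in> U})"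
proof -
  have "openin (GL_topology n) {g \<in> GL n. flag_of K n g \<in> S \<inter> T}"
    if "openin (GL_topology n) {g \<in> GL n. flag_of K n g \<in> S}"
       "openin (GL_topology n) {g \<in> GL n. flag_of K n g \<in> T}" for S T
    using openin_Int[OF that] by (rule back_subst[of "openin _"]) auto
  moreover have "openin (GL_topology n) {g \<in> GL n. flag_of K n g \<in> \<Union>\<K>}"
    if "\<forall>S\<in>\<K>. openin (GL_topology n) {g \<in> GL n. flag_of K n g \<in> S}" for \<K>
  proof -
    have "openin (GL_topology n) (\<Union>S\<in>\<K>. {g \<in> GL n. flag_of K n g \<in> S})"
      using that by auto
    then show ?thesis by (rule back_subst[of "openin _"]) auto
  qed
  ultimately show ?thesis
    unfolding istopology_def by blast
qed

lemma openin_flag_topology: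
  "openin (flag_topology K n) U \<longleftrightarrow>
     U \<subseteq> flags K n \<and> openin (GL_topology n) {g \<in> GL n. flag_of K n g \<in> U}"
  unfolding flag_topology_def by (simp add: topology_inverse'[OF istopology_flag])

definition totally_positive :: "real mat \<Rightarrow> bool" where
  "totally_positive A \<longleftrightarrow>
     (\<forall>I J. I \<subseteq> {..<dim_row A} \<longrightarrow> J \<subseteq> {..<dim_col A} \<longrightarrow> card I = card J \<longrightarrow>
            det (submatrix A I J) > 0)"

definition GL_pos :: "nat \<Rightarrow> real mat set" where
  "GL_pos n = {g \<in> GL n. totally_positive g}"

definition Fl_pos :: "nat set \<Rightarrow> nat \<Rightarrow> (nat \<Rightarrow> real vec set) set" where
  "Fl_pos K n = {V \<in> flags K n. \<exists>g\<in>GL_pos n. represents K n g V}"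

definition Fl_nonneg :: "nat set \<Rightarrow> nat \<Rightarrow> (nat \<Rightarrow> real vec set) set" where
  "Fl_nonneg K n = flag_topology K n closure_of Fl_pos K n"

definition Fl_Plucker_pos :: "nat set \<Rightarrow> nat \<Rightarrow> (nat \<Rightarrow> real vec set) set" where
  "Fl_Plucker_pos K n =
     {V \<in> flags K n. \<exists>A. represents K n A V \<and>
        (\<forall>k\<in>K. \<forall>I. I \<subseteq> {..<n} \<longrightarrow> card I = k \<longrightarrow> det (submatrix A I {..<k}) > 0)}"

definition Fl_Plucker_nonneg :: "nat set \<Rightarrow> nat \<Rightarrow> (nat \<Rightarrow> real vec set) set" where
  "Fl_Plucker_nonneg K n =
     {V \<in> flags K n. \<exists>A. represents K n A V \<and>
        (\<forall>k\<in>K. \<forall>I. I \<subseteq> {..<n} \<longrightarrow> card I = k \<longrightarrow> det (submatrix A I {..<k}) \<ge> 0)}"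

text \<open>The empty set counts as a set of consecutive integers (take \<open>b < a\<close>).\<close>

definition consecutive :: "nat set \<Rightarrow> bool" where
  "consecutive K \<longleftrightarrow> (\<exists>a b. K = {a..b})"

end

(* A flag whose Plucker coordinates of the sizes K = {a..b} are positive is spanned by the columns of
   a totally positive matrix. Append a rows, each an alternating combination of the rows above it, so
   that the maximal minors on the first a columns stay positive; after a change of basis turning the
   appended square block into a signed antidiagonal matrix, every minor on these columns is a maximal
   minor, hence positive. Each of the columns a, ..., b - 1 is then replaced by an alternating
   combination of all previous columns plus a tiny multiple of itself, and the remaining columns are
   appended with rapidly growing entries.

   For every K, the Plucker-nonnegative part is the closure of the Plucker-positive part: adding a small
   multiple of a row to an adjacent row keeps nonnegative minors nonnegative and makes some vanishing
   one positive, and repeating this makes all of them positive.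

   If k < l are neighbours in K with l >= k + 2, the three-term Plucker relations along the missing
   dimensions k, ..., l give an inequality between coordinates of sizes k and l that holds on the
   closure of the totally positive part, but fails for an explicit Plucker-nonnegative flag. *)

theory Submission
  imports Defs
begin

section \<open>Minors\<close>

text \<open>Positive coordinates of sizes a to b give no direct control over minors of smaller sizes
  or on other column sets; these must be made positive without changing the flag. A parameter
  \<open>s\<close> tending to 0 from the right does this: each minor concerned becomes a polynomial
  in \<open>s\<close> whose lowest coefficient is a minor already known to be positive, and as there
  are finitely many, one \<open>s\<close> serves all. The coordinates of each size are fixed only up
  to a scalar of either sign, so a condition on matrices descends to the quotient topology only if
  it survives such rescaling. Hence the closed conditions are built from products that pick up a
  square factor. Neighbours k and k + 1 in \<open>K\<close> give no obstruction: there the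
  three-term relation has only terms of sizes k and k + 1, and its inequality already follows from
  nonnegativity. For l >= k + 2 the chain passes through sizes that \<open>K\<close> does not see.
  The counterexample is built on the vector \<open>e_(k-1) + e_(k+2)\<close>: the two rows in
  between, an even number, keep the signs of its coordinates of size l equal.\<close>

text \<open>Entries come from a function on all pairs of naturals, so rows and columns can be
  appended or replaced without any change of dimensions. \<open>det_submatrix\<close> and
  \<open>det_minor\<close> lead back to matrices.\<close>

definition minor :: "(nat \<Rightarrow> nat \<Rightarrow> 'a::comm_ring_1) \<Rightarrow> nat set \<Rightarrow> nat set \<Rightarrow> 'a" where
  "minor f I J = det (mat (card I) (card J) (\<lambda>(r, c). f (pick I r) (pick J c)))"

text \<open>On \<open>I\<close> this is the inverse of \<open>pick I\<close>; cofactor signs are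
  powers of -1 in these ranks.\<close>

definition pos :: "nat set \<Rightarrow> nat \<Rightarrow> nat" where
  "pos I i = card {a \<in> I. a < i}"

lemma pick_pos: "i \<in> I \<Longrightarrow> pick I (pos I i) = i"
  unfolding pos_def by (rule pick_card_in_set)

lemma pos_pick: "r < card I \<Longrightarrow> pos I (pick I r) = r"
  unfolding pos_def by (rule card_pick_le)

lemma pos_less_card: "finite I \<Longrightarrow> i \<in> I \<Longrightarrow> pos I i < card I"
  unfolding pos_def by (intro psubset_card_mono) auto

lemma pos_less_iff:
  assumes "finite I" "i \<in> I" "x \<in> I"
  shows "pos I i < pos I x \<longleftrightarrow> i < x"
proof
  assume "i < x"
  then show "pos I i < pos I x" unfolding pos_def using assms by (intro psubset_card_mono) auto
next
  assume *: "pos I i < pos I x"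
  show "i < x"
  proof (rule ccontr)
    assume "\<not> i < x"
    then have "pos I x \<le> pos I i" unfolding pos_def using assms by (intro card_mono) auto
    then show False using * by simp
  qed
qed

lemma bij_betw_pick: "finite I \<Longrightarrow> bij_betw (pick I) {..<card I} I"
  by (rule bij_betw_byWitness[where f' = "pos I"])
     (auto simp: pick_pos pos_pick pos_less_card pick_in_set_le)

lemma pos_remove:
  assumes "finite I" "i \<in> I"
  shows "pos (I - {i}) x = (if i < x then pos I x - 1 else pos I x)"
proof -
  have "{a \<in> I - {i}. a < x} = {a \<in> I. a < x} - {i}" by auto
  then show ?thesis using assms unfolding pos_def by (simp add: card_Diff_singleton_if)
qed

text \<open>Deleting a row or column of a matrix renumbers by \<open>insert_index\<close>; its
  agreement with the enumeration of the smaller set is what makes a cofactor again a minor.\<close>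

lemma pick_remove:
  assumes "finite I" "i \<in> I" "r < card I - 1"
  shows "pick (I - {i}) r = pick I (insert_index (pos I i) r)"
proof -
  define x where "x = pick I (insert_index (pos I i) r)"
  have lt: "insert_index (pos I i) r < card I"
    using assms unfolding insert_index_def by auto
  have x: "x \<in> I" unfolding x_def using lt by (rule pick_in_set_le)
  have px: "pos I x = insert_index (pos I i) r" unfolding x_def using lt by (rule pos_pick)
  have "pos I x \<noteq> pos I i" unfolding px insert_index_def by auto
  then have xi: "x \<noteq> i" by auto
  have "pos (I - {i}) x = r"
    using pos_remove[OF assms(1,2), of x] pos_less_iff[OF assms(1,2) x] unfolding px
    by (auto simp: insert_index_def split: if_splits)
  then have "pick (I - {i}) r = x" using pick_pos[of x "I - {i}"] x xi by auto
  then show ?thesis unfolding x_def .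
qed

lemma minor_cong:
  assumes "finite I" "finite J" "\<And>i j. i \<in> I \<Longrightarrow> j \<in> J \<Longrightarrow> f i j = g i j"
  shows "minor f I J = minor g I J"
  unfolding minor_def
  by (rule arg_cong[of _ _ det], rule eq_matI) (auto intro!: assms(3) pick_in_set_le)

lemma minor_transpose:
  assumes "card I = card J"
  shows "minor (\<lambda>j i. f i j) J I = minor f I J"
proof -
  have "mat (card J) (card I) (\<lambda>(r, c). f (pick I c) (pick J r)) =
        transpose_mat (mat (card I) (card J) (\<lambda>(r, c). f (pick I r) (pick J c)))"
    by (rule eq_matI) auto
  then show ?thesis unfolding minor_def
    using det_transpose[of "mat (card I) (card J) (\<lambda>(r, c). f (pick I r) (pick J c))" "card I"] assms by simp
qed

lemma minor_empty [simp]: "minor f {} {} = 1"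
  unfolding minor_def by (simp add: det_def)

lemma minor_expand_col:
  assumes fin: "finite I" "finite J" and card: "card I = card J" and j: "j \<in> J"
  shows "minor f I J = (\<Sum>i\<in>I. (-1) ^ (pos I i + pos J j) * f i j * minor f (I - {i}) (J - {j}))"
proof -
  define A where "A = mat (card I) (card I) (\<lambda>(r, c). f (pick I r) (pick J c))"
  have A: "A \<in> carrier_mat (card I) (card I)" unfolding A_def by simp
  have pj: "pos J j < card I" using pos_less_card[OF fin(2) j] card by simp
  have del: "det (mat_delete A r (pos J j)) = minor f (I - {pick I r}) (J - {j})" if r: "r < card I" for r
  proof -
    have pr: "pick I r \<in> I" "pos I (pick I r) = r" using r by (auto simp: pick_in_set_le pos_pick)
    have "mat_delete A r (pos J j) = mat (card I - 1) (card J - 1)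
       (\<lambda>(r', c'). f (pick (I - {pick I r}) r') (pick (J - {j}) c'))"
    proof (rule eq_matI)
      fix a b assume "a < dim_row (mat (card I - 1) (card J - 1)
       (\<lambda>(r', c'). f (pick (I - {pick I r}) r') (pick (J - {j}) c')))"
       "b < dim_col (mat (card I - 1) (card J - 1)
       (\<lambda>(r', c'). f (pick (I - {pick I r}) r') (pick (J - {j}) c')))"
      then have ab: "a < card I - 1" "b < card J - 1" by auto
      have lt: "insert_index r a < card I" "insert_index (pos J j) b < card I"
        using ab card r pj unfolding insert_index_def by auto
      have "mat_delete A r (pos J j) $$ (a, b) = A $$ (insert_index r a, insert_index (pos J j) b)"
        unfolding mat_delete_def insert_index_def using ab card unfolding A_def by auto
      also have "\<dots> = f (pick (I - {pick I r}) a) (pick (J - {j}) b)"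
        unfolding A_def using lt pick_remove[OF fin(1) pr(1) ab(1)] pick_remove[OF fin(2) j ab(2)] pr(2) by simp
      finally show "mat_delete A r (pos J j) $$ (a, b) = mat (card I - 1) (card J - 1)
       (\<lambda>(r', c'). f (pick (I - {pick I r}) r') (pick (J - {j}) c')) $$ (a, b)" using ab by simp
    qed (auto simp: mat_delete_def A_def card)
    then show ?thesis unfolding minor_def using pr(1) j fin by (simp add: card_Diff_singleton)
  qed
  have "minor f I J = det A" unfolding minor_def A_def card ..
  also have "\<dots> = (\<Sum>r<card I. A $$ (r, pos J j) * cofactor A r (pos J j))"
    by (rule laplace_expansion_column[OF A pj])
  also have "\<dots> = (\<Sum>r<card I. (-1) ^ (pos I (pick I r) + pos J j) * f (pick I r) j * minor f (I - {pick I r}) (J - {j}))"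
  proof (rule sum.cong[OF refl])
    fix r assume r: "r \<in> {..<card I}"
    have "A $$ (r, pos J j) = f (pick I r) j" unfolding A_def using r pj by (simp add: pick_pos[OF j])
    then show "A $$ (r, pos J j) * cofactor A r (pos J j) =
      (-1) ^ (pos I (pick I r) + pos J j) * f (pick I r) j * minor f (I - {pick I r}) (J - {j})"
      using r by (simp add: cofactor_def del pos_pick)
  qed
  also have "\<dots> = (\<Sum>i\<in>I. (-1) ^ (pos I i + pos J j) * f i j * minor f (I - {i}) (J - {j}))"
    by (rule sum.reindex_bij_betw[OF bij_betw_pick[OF fin(1)]])
  finally show ?thesis .
qed

lemma minor_expand_row:
  assumes fin: "finite I" "finite J" and card: "card I = card J" and i: "i \<in> I"
  shows "minor f I J = (\<Sum>j\<in>J. (-1) ^ (pos I i + pos J j) * f i j * minor f (I - {i}) (J - {j}))"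
proof -
  have "minor f I J = minor (\<lambda>j i. f i j) J I" using minor_transpose[OF card, of f] by simp
  also have "\<dots> = (\<Sum>j\<in>J. (-1) ^ (pos J j + pos I i) * f i j * minor (\<lambda>j i. f i j) (J - {j}) (I - {i}))"
    by (rule minor_expand_col[OF fin(2,1) card[symmetric] i])
  also have "\<dots> = (\<Sum>j\<in>J. (-1) ^ (pos I i + pos J j) * f i j * minor f (I - {i}) (J - {j}))"
    using card i fin by (intro sum.cong refl) (simp add: minor_transpose[of "I - {i}" _ f] card_Diff_singleton add.commute)
  finally show ?thesis .
qed

lemma minor_identical_cols:
  assumes fin: "finite I" "finite J" and card: "card I = card J" and "c \<in> J" "d \<in> J" "c \<noteq> d"
    and "\<And>i. i \<in> I \<Longrightarrow> f i c = f i d"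
  shows "minor f I J = 0"
  unfolding minor_def
proof (rule det_identical_columns[of _ "card I" "pos J c" "pos J d"])
  show "pos J c \<noteq> pos J d" using assms by (metis pick_pos)
  show "pos J c < card I" "pos J d < card I" using assms pos_less_card by auto
  then show "col (mat (card I) (card J) (\<lambda>(r, c). f (pick I r) (pick J c))) (pos J c) =
    col (mat (card I) (card J) (\<lambda>(r, c). f (pick I r) (pick J c))) (pos J d)"
    using assms by (intro eq_vecI) (auto simp: pick_pos pick_in_set_le)
qed (use card in auto)

lemma minor_one:
  assumes "card I = card J" "\<And>i j. i \<in> I \<Longrightarrow> j \<in> J \<Longrightarrow> f i j = (if pos I i = pos J j then 1 else 0)"
  shows "minor f I J = 1"
proof -
  have "mat (card I) (card J) (\<lambda>(r, c). f (pick I r) (pick J c)) = 1\<^sub>m (card I)"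
    by (rule eq_matI) (auto simp: assms pick_in_set_le pos_pick)
  then show ?thesis unfolding minor_def by simp
qed

lemma minor_zero_col:
  assumes "finite I" "finite J" "card I = card J" "j \<in> J" "\<And>i. i \<in> I \<Longrightarrow> f i j = 0"
  shows "minor f I J = 0"
  using minor_expand_col[OF assms(1-4), of f] assms(5) by simp

lemma minor_zero_row:
  assumes "finite I" "finite J" "card I = card J" "i \<in> I" "\<And>j. j \<in> J \<Longrightarrow> f i j = 0"
  shows "minor f I J = 0"
  using minor_expand_row[OF assms(1-4), of f] assms(5) by simp

section \<open>Minors as linear functions of one column\<close>

definition col_upd :: "(nat \<Rightarrow> nat \<Rightarrow> 'a) \<Rightarrow> nat \<Rightarrow> (nat \<Rightarrow> 'a) \<Rightarrow> nat \<Rightarrow> nat \<Rightarrow> 'a" where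
  "col_upd f m g = (\<lambda>i j. if j = m then g i else f i j)"

text \<open>Cofactors along column \<open>m\<close> do not see that column, so they can be taken in
  \<open>f\<close>. Linearity, scaling and the copying rule below all come from this
  formula.\<close>

lemma minor_col_upd_expand:
  assumes "finite I" "finite J" "card I = card J" "m \<in> J"
  shows "minor (col_upd f m g) I J =
     (\<Sum>i\<in>I. (-1) ^ (pos I i + pos J m) * g i * minor f (I - {i}) (J - {m}))"
  unfolding minor_expand_col[OF assms]
  by (intro sum.cong refl arg_cong2[of _ _ _ _ times] minor_cong) (use assms in \<open>auto simp: col_upd_def\<close>)

lemma minor_col_upd_linear:
  assumes "finite I" "finite J" "card I = card J" "m \<in> J"
  shows "minor (col_upd f m (\<lambda>i. \<Sum>c\<in>C. x c * g c i)) I J = (\<Sum>c\<in>C. x c * minor (col_upd f m (g c)) I J)"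
  unfolding minor_col_upd_expand[OF assms] sum_distrib_left sum_distrib_right
  by (subst sum.swap) (simp add: mult_ac)

lemma minor_col_upd_add:
  assumes "finite I" "finite J" "card I = card J" "m \<in> J"
  shows "minor (col_upd f m (\<lambda>i. g i + h i)) I J = minor (col_upd f m g) I J + minor (col_upd f m h) I J"
  unfolding minor_col_upd_expand[OF assms] by (simp add: algebra_simps sum.distrib)

lemma minor_col_upd_scale:
  assumes "finite I" "finite J" "card I = card J" "m \<in> J"
  shows "minor (col_upd f m (\<lambda>i. x * g i)) I J = x * minor (col_upd f m g) I J"
  unfolding minor_col_upd_expand[OF assms] by (simp add: sum_distrib_left mult_ac)

text \<open>Replacing the last column by a copy of column \<open>c\<close> and moving it to its proper place costs one
  sign for every selected column to the right of \<open>c\<close>.\<close>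

lemma minor_col_upd_copy:
  assumes fin: "finite I" and J: "J \<subseteq> {..<m}" and card: "card I = Suc (card J)"
  shows "minor (col_upd f m (\<lambda>i. f i c)) I (insert m J) =
     (if c \<in> J then 0 else (-1) ^ card {j \<in> J. c < j} * minor f I (insert c J))"
proof (cases "c \<in> J")
  case True
  have "minor (col_upd f m (\<lambda>i. f i c)) I (insert m J) = 0"
    using True J card finite_subset[OF J] fin
    by (intro minor_identical_cols[of _ _ c m]) (auto simp: col_upd_def card_insert_if)
  then show ?thesis using True by simp
next
  case False
  have finJ: "finite J" using J finite_subset by auto
  have mJ: "m \<notin> J" using J by auto
  have posm: "pos (insert m J) m = card J" unfolding pos_def using J by (intro arg_cong[of _ _ card]) auto
  have "J = {a \<in> insert c J. a < c} \<union> {j \<in> J. c < j}" (is "_ = ?A \<union> ?B")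
  proof (rule Set.set_eqI)
    fix x show "x \<in> J \<longleftrightarrow> x \<in> ?A \<union> ?B"
      using False by (cases x c rule: linorder_cases) auto
  qed
  then have "card J = card (?A \<union> ?B)" by (rule arg_cong)
  also have "\<dots> = card ?A + card ?B" using finJ by (intro card_Un_disjoint) auto
  finally have cardJ: "card J = pos (insert c J) c + card ?B" unfolding pos_def .
  have "minor (col_upd f m (\<lambda>i. f i c)) I (insert m J) =
      (\<Sum>i\<in>I. (-1) ^ (pos I i + card J) * f i c * minor f (I - {i}) J)"
    using minor_col_upd_expand[of I "insert m J" m f] fin finJ mJ card posm by simp
  also have "\<dots> = (-1) ^ card {j \<in> J. c < j} * (\<Sum>i\<in>I. (-1) ^ (pos I i + pos (insert c J) c) * f i c * minor f (I - {i}) J)"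
    unfolding cardJ sum_distrib_left by (intro sum.cong refl) (simp add: power_add)
  also have "(\<Sum>i\<in>I. (-1) ^ (pos I i + pos (insert c J) c) * f i c * minor f (I - {i}) J) = minor f I (insert c J)"
    using minor_expand_col[of I "insert c J" c f] fin finJ False card by simp
  finally show ?thesis using False by simp
qed

lemma minor_col_upd_irrelevant:
  "finite I \<Longrightarrow> finite J \<Longrightarrow> m \<notin> J \<Longrightarrow> minor (col_upd f m g) I J = minor f I J"
  by (rule minor_cong) (auto simp: col_upd_def)

lemma pick_lessThan: "c < n \<Longrightarrow> pick {..<n} c = c"
proof -
  assume "c < n"
  then have "pos {..<n} c = card {..<c}" unfolding pos_def by (intro arg_cong[of _ _ card]) auto
  then show ?thesis using pick_pos[of c "{..<n}"] \<open>c < n\<close> by simp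
qed

text \<open>A change of basis of the first k columns multiplies all maximal minors by one
  determinant; this relates different representatives of a flag.\<close>

lemma minor_mult:
  assumes I: "finite I" "card I = k"
    and M: "M \<in> carrier_mat k k"
    and h: "\<And>i j. i \<in> I \<Longrightarrow> j < k \<Longrightarrow> h i j = (\<Sum>c<k. f i c * M $$ (c, j))"
  shows "minor h I {..<k} = minor f I {..<k} * det M"
proof -
  have "mat k k (\<lambda>(r, c). h (pick I r) (pick {..<k} c)) = mat k k (\<lambda>(r, c). f (pick I r) (pick {..<k} c)) * M"
  proof (rule eq_matI)
    fix r j assume "r < dim_row (mat k k (\<lambda>(r, c). f (pick I r) (pick {..<k} c)) * M)"
      "j < dim_col (mat k k (\<lambda>(r, c). f (pick I r) (pick {..<k} c)) * M)"
    then have rj: "r < k" "j < k" using M by auto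
    have "(mat k k (\<lambda>(r, c). f (pick I r) (pick {..<k} c)) * M) $$ (r, j) = (\<Sum>c\<in>{0..<k}. f (pick I r) (pick {..<k} c) * M $$ (c, j))"
      using rj M by (simp add: scalar_prod_def)
    also have "\<dots> = (\<Sum>c<k. f (pick I r) c * M $$ (c, j))"
      by (rule sum.cong) (auto simp: pick_lessThan)
    finally show "mat k k (\<lambda>(r, c). h (pick I r) (pick {..<k} c)) $$ (r, j) =
      (mat k k (\<lambda>(r, c). f (pick I r) (pick {..<k} c)) * M) $$ (r, j)"
      using rj I by (simp add: h pick_in_set_le pick_lessThan)
  qed (use M in auto)
  then show ?thesis unfolding minor_def using det_mult[of _ k M] M I by simp
qed

lemma det_submatrix:
  assumes "I \<subseteq> {..<dim_row A}" "J \<subseteq> {..<dim_col A}"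
  shows "det (submatrix A I J) = minor (\<lambda>i j. A $$ (i, j)) I J"
proof -
  have "{i. i < dim_row A \<and> i \<in> I} = I" "{j. j < dim_col A \<and> j \<in> J} = J" using assms by auto
  then show ?thesis unfolding submatrix_def minor_def by simp
qed

lemma det_minor:
  assumes "A \<in> carrier_mat n n"
  shows "det A = minor (\<lambda>i j. A $$ (i, j)) {..<n} {..<n}"
proof -
  show ?thesis unfolding minor_def using assms by (intro arg_cong[of _ _ det] eq_matI) (auto simp: pick_lessThan)
qed

section \<open>Construction of totally positive arrays\<close>

text \<open>After division by \<open>s ^ e m\<close>, every other term still carries a positive
  power of \<open>s\<close>, so the sum tends to \<open>c m\<close>.\<close>

lemma eventually_lowest_order_pos:
  fixes c :: "'a \<Rightarrow> real" and e :: "'a \<Rightarrow> nat"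
  assumes "finite E" "m \<in> E" "c m > 0" "\<And>x. x \<in> E \<Longrightarrow> x \<noteq> m \<Longrightarrow> e m < e x"
  shows "eventually (\<lambda>s. (\<Sum>x\<in>E. c x * s ^ e x) > 0) (at_right 0)"
proof -
  have "((\<lambda>s. c m + (\<Sum>x\<in>E - {m}. c x * s ^ (e x - e m))) \<longlongrightarrow> c m + (\<Sum>x\<in>E - {m}. c x * 0 ^ (e x - e m))) (at_right 0)"
    by (intro tendsto_intros)
  moreover have "(\<Sum>x\<in>E - {m}. c x * 0 ^ (e x - e m)) = 0"
    by (intro sum.neutral) (use assms(4) in \<open>force simp: power_0_left\<close>)
  ultimately have "((\<lambda>s. c m + (\<Sum>x\<in>E - {m}. c x * s ^ (e x - e m))) \<longlongrightarrow> c m) (at_right 0)" by simp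
  then have "eventually (\<lambda>s. c m + (\<Sum>x\<in>E - {m}. c x * s ^ (e x - e m)) > 0) (at_right 0)"
    using assms(3) by (simp add: order_tendsto_iff)
  moreover have "eventually (\<lambda>s::real. s > 0) (at_right 0)" by (simp add: eventually_at_right_less)
  ultimately show ?thesis
  proof eventually_elim
    case (elim s)
    have "(\<Sum>x\<in>E. c x * s ^ e x) = c m * s ^ e m + (\<Sum>x\<in>E - {m}. c x * s ^ e x)"
      by (rule sum.remove) (use assms in auto)
    also have "(\<Sum>x\<in>E - {m}. c x * s ^ e x) = (\<Sum>x\<in>E - {m}. s ^ e m * (c x * s ^ (e x - e m)))"
    proof (rule sum.cong[OF refl])
      fix x assume "x \<in> E - {m}"
      then have "s ^ e x = s ^ e m * s ^ (e x - e m)"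
        using assms(4)[of x] by (simp add: power_add[symmetric])
      then show "c x * s ^ e x = s ^ e m * (c x * s ^ (e x - e m))" by simp
    qed
    also have "c m * s ^ e m + \<dots> = s ^ e m * (c m + (\<Sum>x\<in>E - {m}. c x * s ^ (e x - e m)))"
      by (simp add: distrib_left sum_distrib_left)
    finally have "(\<Sum>x\<in>E. c x * s ^ e x) = s ^ e m * (c m + (\<Sum>x\<in>E - {m}. c x * s ^ (e x - e m)))" .
    then show ?case using elim by simp
  qed
qed

text \<open>The exponents m - 1 - c are distinct and below m: for small \<open>s\<close> the
  rightmost contributing column dominates, and \<open>g\<close> decides only when no earlier column
  contributes.\<close>

definition alt_comb :: "(nat \<Rightarrow> nat \<Rightarrow> real) \<Rightarrow> nat \<Rightarrow> (nat \<Rightarrow> real) \<Rightarrow> real \<Rightarrow> nat \<Rightarrow> real" where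
  "alt_comb f m g s = (\<lambda>i. (\<Sum>c<m. (-s) ^ (m - 1 - c) * f i c) + s ^ m * g i)"

lemma minor_alt_comb:
  assumes fin: "finite I" and J: "J \<subseteq> {..<m}" and card: "card I = Suc (card J)"
  shows "minor (col_upd f m (alt_comb f m g s)) I (insert m J) =
    (\<Sum>c\<in>{..<m} - J. ((-1) ^ (m - 1 - c) * (-1) ^ card {j \<in> J. c < j} * minor f I (insert c J)) * s ^ (m - 1 - c))
    + minor (col_upd f m g) I (insert m J) * s ^ m"
proof -
  have "m \<notin> J" "finite J" using J finite_subset by auto
  then have *: "finite (insert m J)" "card I = card (insert m J)" "m \<in> insert m J" using card by auto
  have neg: "(-s) ^ k = (-1) ^ k * s ^ k" for k by (rule power_minus)
  have "minor (col_upd f m (alt_comb f m g s)) I (insert m J) =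
    (\<Sum>c<m. (-s) ^ (m - 1 - c) * minor (col_upd f m (\<lambda>i. f i c)) I (insert m J))
    + s ^ m * minor (col_upd f m g) I (insert m J)"
    unfolding alt_comb_def minor_col_upd_add[OF fin *] minor_col_upd_scale[OF fin *] minor_col_upd_linear[OF fin *] ..
  also have "(\<Sum>c<m. (-s) ^ (m - 1 - c) * minor (col_upd f m (\<lambda>i. f i c)) I (insert m J)) =
    (\<Sum>c\<in>{..<m} - J. ((-1) ^ (m - 1 - c) * (-1) ^ card {j \<in> J. c < j} * minor f I (insert c J)) * s ^ (m - 1 - c))"
    \<comment> \<open>A copy of a column already in \<open>J\<close> contributes nothing.\<close>
    unfolding minor_col_upd_copy[OF fin J card]
    by (rule sum.mono_neutral_cong_right) (auto simp: neg)
  finally show ?thesis by simp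
qed

text \<open>As \<open>s \<rightarrow> 0\<close> the largest column missing from \<open>J\<close> dominates; the alternating signs in
  \<^const>\<open>alt_comb\<close> cancel the sign of moving the new column past the columns behind it.\<close>

lemma eventually_minor_alt_comb_pos:
  assumes fin: "finite I" and J: "J \<subset> {..<m}" and card: "card I = Suc (card J)"
    and pos: "\<And>c. c < m \<Longrightarrow> c \<notin> J \<Longrightarrow> minor f I (insert c J) > 0"
  shows "eventually (\<lambda>s. minor (col_upd f m (alt_comb f m g s)) I (insert m J) > 0) (at_right 0)"
proof -
  define E where "E = {..<m} - J"
  define c0 where "c0 = Max E"
  define e where "e c = (if c = m then m else m - 1 - c)" for c
  define x where "x c = (if c = m then minor (col_upd f m g) I (insert m J)
     else (-1) ^ (m - 1 - c) * (-1) ^ card {j \<in> J. c < j} * minor f I (insert c J))" for c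
  have E: "finite E" "E \<noteq> {}" "m \<notin> E" using J unfolding E_def by auto
  then have c0: "c0 \<in> E" and max: "\<And>c. c \<in> E \<Longrightarrow> c \<le> c0" unfolding c0_def by auto
  \<comment> \<open>Every column to the right of \<open>c0\<close> lies in \<open>J\<close>, so the
    copy passes m - 1 - c0 columns, which is also the exponent of its weight.\<close>
  have "{j \<in> J. c0 < j} = {Suc c0..<m}"
  proof (rule equalityI; rule subsetI)
    fix x assume x: "x \<in> {Suc c0..<m}"
    have "x \<in> J"
    proof (rule ccontr)
      assume "x \<notin> J"
      then have "x \<le> c0" using max x unfolding E_def by auto
      then show False using x by simp
    qed
    then show "x \<in> {j \<in> J. c0 < j}" using x by simp
  qed (use J in auto)
  then have "x c0 > 0" using pos[of c0] c0 E unfolding x_def E_def by (auto simp: power_add[symmetric])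
  moreover have "e c0 < e c" if "c \<in> insert m E" "c \<noteq> c0" for c
    using that c0 max[of c] unfolding e_def E_def by auto
  ultimately have "eventually (\<lambda>s. (\<Sum>c\<in>insert m E. x c * s ^ e c) > 0) (at_right 0)"
    using E c0 by (intro eventually_lowest_order_pos[of _ c0]) auto
  moreover have "(\<Sum>c\<in>insert m E. x c * s ^ e c) = minor (col_upd f m (alt_comb f m g s)) I (insert m J)" for s
  proof -
    have "(\<Sum>c\<in>insert m E. x c * s ^ e c) = x m * s ^ e m + (\<Sum>c\<in>E. x c * s ^ e c)"
      using E by simp
    also have "(\<Sum>c\<in>E. x c * s ^ e c) = (\<Sum>c\<in>E. ((-1) ^ (m - 1 - c) * (-1) ^ card {j \<in> J. c < j} * minor f I (insert c J)) * s ^ (m - 1 - c))"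
      using E by (intro sum.cong) (auto simp: x_def e_def)
    finally show ?thesis using J unfolding minor_alt_comb[OF fin psubset_imp_subset[OF J] card] E_def
      by (simp add: x_def e_def)
  qed
  ultimately show ?thesis by simp
qed

text \<open>With all earlier columns selected, every copied column is a repetition and only the
  multiple of \<open>g\<close> survives.\<close>

lemma minor_alt_comb_full:
  assumes "finite I" "card I = Suc m"
  shows "minor (col_upd f m (alt_comb f m g s)) I {..<Suc m} = minor (col_upd f m g) I {..<Suc m} * s ^ m"
  using minor_alt_comb[of I "{..<m}" m f g s] assms by (simp add: lessThan_Suc)

definition TP :: "nat \<Rightarrow> nat \<Rightarrow> (nat \<Rightarrow> nat \<Rightarrow> real) \<Rightarrow> bool" where
  "TP n m f \<longleftrightarrow> (\<forall>I J. I \<subseteq> {..<n} \<longrightarrow> J \<subseteq> {..<m} \<longrightarrow> card I = card J \<longrightarrow> minor f I J > 0)"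

lemma TP_D: "TP n m f \<Longrightarrow> I \<subseteq> {..<n} \<Longrightarrow> J \<subseteq> {..<m} \<Longrightarrow> card I = card J \<Longrightarrow> minor f I J > 0"
  unfolding TP_def by blast

lemma TP_0: "TP n 0 f"
  unfolding TP_def by (auto dest: finite_subset)

text \<open>Only the minors containing the new column depend on \<open>s\<close>, and they are
  finitely many, so the separate eventual statements combine.\<close>

lemma TP_Suc_eventually:
  assumes tp: "TP n m f"
    and ev: "\<And>I J. I \<subseteq> {..<n} \<Longrightarrow> J \<subseteq> {..<m} \<Longrightarrow> card I = Suc (card J) \<Longrightarrow>
      eventually (\<lambda>s. minor (col_upd f m (g s)) I (insert m J) > 0) (at_right (0::real))"
  shows "eventually (\<lambda>s. TP n (Suc m) (col_upd f m (g s))) (at_right 0)"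
proof -
  define P where "P = {(I, J). I \<subseteq> {..<n} \<and> J \<subseteq> {..<m} \<and> card I = Suc (card J)}"
  have "P \<subseteq> Pow {..<n} \<times> Pow {..<m}" unfolding P_def by auto
  then have "finite P" by (rule finite_subset) auto
  then have "eventually (\<lambda>s. \<forall>p\<in>P. minor (col_upd f m (g s)) (fst p) (insert m (snd p)) > 0) (at_right 0)"
    by (intro eventually_ball_finite) (auto simp: P_def intro!: ev)
  then show ?thesis
  proof eventually_elim
    case (elim s)
    show ?case unfolding TP_def
    proof (intro allI impI)
      fix I J assume *: "I \<subseteq> {..<n}" "J \<subseteq> {..<Suc m}" "card I = card J"
      have fin: "finite I" "finite J" using * finite_subset by auto
      show "minor (col_upd f m (g s)) I J > 0"
      proof (cases "m \<in> J")
        case True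
        have "J - {m} \<subseteq> {..<m}" using *(2) unfolding lessThan_Suc by blast
        moreover have "card I = Suc (card (J - {m}))" using *(3) card.remove[OF fin(2) True] by (rule trans)
        ultimately have "(I, J - {m}) \<in> P" unfolding P_def using *(1) by simp
        then show ?thesis using elim True by (auto simp: insert_absorb)
      next
        case False
        then have "J \<subseteq> {..<m}" using *(2) unfolding lessThan_Suc by blast
        then show ?thesis using TP_D[OF tp *(1) _ *(3)] False fin by (simp add: minor_col_upd_irrelevant)
      qed
    qed
  qed
qed

lemma at_right_obtain:
  assumes "eventually P (at_right (0::real))"
  obtains s where "s > 0" "P s"
proof -
  have "eventually (\<lambda>s. s > 0 \<and> P s) (at_right (0::real))"
    using assms eventually_at_right_less[of "0::real"] by (rule eventually_conj[rotated])
  then show thesis using that eventually_happens'[OF trivial_limit_at_right_real] by blast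
qed

text \<open>Each entry \<open>s ^ (n - 1 - i)\<close> is 1/s times the one above it, so the lowest
  selected row dominates the expansion along the new column. That entry is last in both row and
  column order, so its cofactor has sign plus.\<close>

lemma TP_append_col:
  assumes tp: "TP n m f"
  obtains g where "TP n (Suc m) (col_upd f m g)"
proof -
  have "eventually (\<lambda>s. TP n (Suc m) (col_upd f m (\<lambda>i. s ^ (n - 1 - i)))) (at_right 0)"
  proof (rule TP_Suc_eventually[OF tp])
    fix I J assume *: "I \<subseteq> {..<n}" "J \<subseteq> {..<m}" "card I = Suc (card J)"
    have fin: "finite I" "finite J" using * finite_subset by auto
    have mJ: "m \<notin> J" using * by auto
    have pm: "pos (insert m J) m = card J" unfolding pos_def using * by (intro arg_cong[of _ _ card]) auto
    define x where "x i = (-1) ^ (pos I i + card J) * minor f (I - {i}) J" for i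
    define i0 where "i0 = Max I"
    have ne: "I \<noteq> {}" using * by auto
    have i0: "i0 \<in> I" and max: "\<And>i. i \<in> I \<Longrightarrow> i \<le> i0" unfolding i0_def using fin ne by auto
    have "{a \<in> I. a < i0} = I - {i0}" using max by fastforce
    then have "pos I i0 = card J" unfolding pos_def using * i0 fin by simp
    moreover have "minor f (I - {i0}) J > 0" using * i0 fin by (intro TP_D[OF tp]) auto
    ultimately have "x i0 > 0" unfolding x_def by (simp add: power_add[symmetric])
    moreover have "n - 1 - i0 < n - 1 - i" if "i \<in> I" "i \<noteq> i0" for i
      using max[OF that(1)] that i0 * by auto
    ultimately have "eventually (\<lambda>s. (\<Sum>i\<in>I. x i * s ^ (n - 1 - i)) > 0) (at_right 0)"
      using i0 fin by (intro eventually_lowest_order_pos[of _ i0]) auto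
    moreover have "(\<Sum>i\<in>I. x i * s ^ (n - 1 - i)) = minor (col_upd f m (\<lambda>i. s ^ (n - 1 - i))) I (insert m J)" for s
      using fin mJ * by (subst minor_col_upd_expand) (auto simp: pm x_def mult_ac intro!: sum.cong)
    ultimately show "eventually (\<lambda>s. minor (col_upd f m (\<lambda>i. s ^ (n - 1 - i))) I (insert m J) > 0) (at_right 0)"
      by simp
  qed
  then show thesis using that at_right_obtain by metis
qed

lemma TP_append_cols:
  assumes "TP n m f"
  shows "\<exists>h. TP n (m + p) h \<and> (\<forall>i. \<forall>j<m. h i j = f i j)"
proof (induction p)
  case 0
  then show ?case using assms by auto
next
  case (Suc p)
  then obtain h where h: "TP n (m + p) h" "\<forall>i. \<forall>j<m. h i j = f i j" by blast
  obtain g where "TP n (Suc (m + p)) (col_upd h (m + p) g)" by (rule TP_append_col[OF h(1)])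
  then show ?case using h(2) by (intro exI[of _ "col_upd h (m + p) g"]) (auto simp: col_upd_def)
qed

text \<open>Two kinds of minors contain the new column. If an earlier column is missing from the
  selection, the copies dominate; if none is missing, the minor is a positive multiple of one from
  \<open>full\<close>.\<close>

lemma TP_alt_comb:
  assumes tp: "TP n m f"
    and full: "\<And>I. I \<subseteq> {..<n} \<Longrightarrow> card I = Suc m \<Longrightarrow> minor (col_upd f m g) I {..<Suc m} > 0"
  obtains s where "TP n (Suc m) (col_upd f m (alt_comb f m g s))"
proof -
  have "eventually (\<lambda>s. TP n (Suc m) (col_upd f m (alt_comb f m g s))) (at_right 0)"
  proof (rule TP_Suc_eventually[OF tp])
    fix I J assume *: "I \<subseteq> {..<n}" "J \<subseteq> {..<m}" "card I = Suc (card J)"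
    have fin: "finite I" "finite J" using * finite_subset by auto
    show "eventually (\<lambda>s. minor (col_upd f m (alt_comb f m g s)) I (insert m J) > 0) (at_right 0)"
    proof (cases "J = {..<m}")
      case True
      have "eventually (\<lambda>s::real. s > 0) (at_right 0)" by (simp add: eventually_at_right_less)
      then show ?thesis
        by (rule eventually_mono) (use True * fin full minor_alt_comb_full[of I m f g] in \<open>auto simp: lessThan_Suc\<close>)
    next
      case False
      then show ?thesis using * fin
        by (intro eventually_minor_alt_comb_pos) (auto intro!: TP_D[OF tp])
    qed
  qed
  then show thesis using that at_right_obtain by metis
qed

section \<open>From positive maximal minors to a totally positive matrix\<close>

definition max_minors_pos :: "nat \<Rightarrow> nat \<Rightarrow> (nat \<Rightarrow> nat \<Rightarrow> real) \<Rightarrow> bool" where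
  "max_minors_pos n a f \<longleftrightarrow> (\<forall>I. I \<subseteq> {..<n} \<longrightarrow> card I = a \<longrightarrow> minor f I {..<a} > 0)"

text \<open>The alternating combination is applied to the transpose. A selection with the new row
  uses a - 1 old rows, and \<open>a \<le> n\<close> leaves an old row to be copied, so the copies
  alone give positivity and \<open>g\<close> is taken to be zero.\<close>

lemma max_minors_pos_append_row:
  assumes pos: "max_minors_pos n a f" and an: "a \<le> n"
  shows "\<exists>g. max_minors_pos (Suc n) a (\<lambda>i j. if i = n then g j else f i j)"
proof -
  define ft where "ft = (\<lambda>j i. f i j)"
  define P where "P = {I. I \<subseteq> {..<n} \<and> Suc (card I) = a}"
  have fP: "finite P" unfolding P_def by simp
  have "eventually (\<lambda>s. \<forall>I\<in>P. minor (col_upd ft n (alt_comb ft n (\<lambda>_. 0) s)) {..<a} (insert n I) > 0) (at_right 0)"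
  proof (rule eventually_ball_finite[OF fP], rule ballI)
    fix I assume "I \<in> P"
    then have I: "I \<subseteq> {..<n}" "Suc (card I) = a" unfolding P_def by auto
    then have "I \<noteq> {..<n}" using an by auto
    then have psub: "I \<subset> {..<n}" using I by auto
    have fin: "finite I" using I finite_subset by auto
    have "minor ft {..<a} (insert c I) > 0" if "c < n" "c \<notin> I" for c
    proof -
      have "card (insert c I) = a" using that I fin by simp
      then have "minor ft {..<a} (insert c I) = minor f (insert c I) {..<a}"
        unfolding ft_def by (intro minor_transpose) simp
      also have "\<dots> > 0" using pos that I fin unfolding max_minors_pos_def by auto
      finally show ?thesis .
    qed
    then show "eventually (\<lambda>s. minor (col_upd ft n (alt_comb ft n (\<lambda>_. 0) s)) {..<a} (insert n I) > 0) (at_right 0)"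
      using I by (intro eventually_minor_alt_comb_pos[OF _ psub]) auto
  qed
  then obtain s where s: "\<forall>I\<in>P. minor (col_upd ft n (alt_comb ft n (\<lambda>_. 0) s)) {..<a} (insert n I) > 0"
    by (rule at_right_obtain)
  define g where "g = alt_comb ft n (\<lambda>_. 0) s"
  define h where "h = (\<lambda>i j. if i = n then g j else f i j)"
  have "minor h I {..<a} > 0" if I: "I \<subseteq> {..<Suc n}" "card I = a" for I
  proof (cases "n \<in> I")
    case True
    have fin: "finite I" using I finite_subset by auto
    have "I - {n} \<subseteq> {..<n}" using I(1) unfolding lessThan_Suc by blast
    moreover have "Suc (card (I - {n})) = a" using I(2) card.remove[OF fin True] by simp
    ultimately have "I - {n} \<in> P" unfolding P_def by simp
    then have "minor (\<lambda>j i. h i j) {..<a} I > 0"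
      using s True unfolding h_def g_def col_upd_def ft_def by (auto simp: insert_absorb)
    then show ?thesis using minor_transpose[of I "{..<a}" h] I by simp
  next
    case False
    then have "I \<subseteq> {..<n}" using I(1) unfolding lessThan_Suc by blast
    moreover have "minor h I {..<a} = minor f I {..<a}"
      using I finite_subset False by (intro minor_cong) (auto simp: h_def)
    ultimately show ?thesis using pos I unfolding max_minors_pos_def by auto
  qed
  then show ?thesis unfolding max_minors_pos_def h_def by blast
qed

lemma max_minors_pos_append_rows:
  assumes "max_minors_pos n a f" "a \<le> n"
  shows "\<exists>h. max_minors_pos (n + p) a h \<and> (\<forall>i<n. \<forall>j. h i j = f i j)"
proof (induction p)
  case 0
  then show ?case using assms by auto
next
  case (Suc p)
  then obtain h where h: "max_minors_pos (n + p) a h" "\<forall>i<n. \<forall>j. h i j = f i j" by blast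
  obtain g where "max_minors_pos (Suc (n + p)) a (\<lambda>i j. if i = n + p then g j else h i j)"
    using max_minors_pos_append_row[OF h(1)] assms by auto
  then show ?case using h(2) by (intro exI[of _ "\<lambda>i j. if i = n + p then g j else h i j"]) auto
qed

lemma atLeastLessThan_Suc_left: "q < a \<Longrightarrow> {q..<a} = insert q {Suc q..<a::nat}"
  by auto

text \<open>If column \<open>q\<close> is missing from \<open>J\<close> but all later ones are
  present, adjoin \<open>q\<close> together with row n + (a - 1 - q), whose only entry in the first
  a columns is a sign in column \<open>q\<close>. Expansion along this row returns the old minor,
  since the total sign exponent is twice \<open>card J\<close>. The bound on \<open>R\<close>
  ensures that the row is new. Lowering \<open>q\<close> to 0 fills all columns.\<close>

lemma minor_eq_maximal_minor:
  fixes h :: "nat \<Rightarrow> nat \<Rightarrow> real"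
  assumes h: "\<And>r c. r < a \<Longrightarrow> c < a \<Longrightarrow> h (n + r) c = (if r + c = a - 1 then (-1) ^ r else 0)"
  shows "q \<le> a \<Longrightarrow> R \<subseteq> {..<n + (a - q)} \<Longrightarrow> {q..<a} \<subseteq> J \<Longrightarrow> J \<subseteq> {..<a} \<Longrightarrow> card R = card J \<Longrightarrow>
    \<exists>R'\<subseteq>{..<n + a}. card R' = a \<and> minor h R J = minor h R' {..<a}"
proof (induction q arbitrary: R J)
  case 0
  then have "J = {..<a}" by (auto simp: atLeast0LessThan)
  then show ?case using 0 by (intro exI[of _ R]) auto
next
  case (Suc q)
  have fin: "finite R" "finite J" using Suc.prems by (meson finite_subset finite_lessThan)+
  show ?case
  proof (cases "q \<in> J")
    case True
    have "{q..<a} \<subseteq> J" using Suc.prems(1,3) True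
      by (subst atLeastLessThan_Suc_left) auto
    moreover have "R \<subseteq> {..<n + (a - q)}" using Suc.prems(2) by auto
    ultimately show ?thesis using Suc.IH[of R J] Suc.prems by simp
  next
    case False
    define N where "N = n + (a - 1 - q)"
    have NR: "N \<notin> R" "R \<subseteq> {..<N}" using Suc.prems unfolding N_def by auto
    have "{q..<a} \<subseteq> insert q J" using Suc.prems(1,3) by (subst atLeastLessThan_Suc_left) auto
    moreover have "insert N R \<subseteq> {..<n + (a - q)}" using Suc.prems unfolding N_def by auto
    ultimately obtain R' where R': "R' \<subseteq> {..<n + a}" "card R' = a" "minor h (insert N R) (insert q J) = minor h R' {..<a}"
      using Suc.IH[of "insert N R" "insert q J"] Suc.prems NR False fin by auto
    have hN: "h N j = (if j = q then (-1) ^ (a - 1 - q) else 0)" if "j \<in> insert q J" for j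
      using h[of "a - 1 - q" j] that Suc.prems unfolding N_def by auto
    have pN: "pos (insert N R) N = card J"
      unfolding pos_def Suc.prems(5)[symmetric] using NR by (intro arg_cong[of _ _ card]) auto
    have "J = {x \<in> J. x < q} \<union> {Suc q..<a}"
    proof (rule Set.set_eqI)
      fix x show "x \<in> J \<longleftrightarrow> x \<in> {x \<in> J. x < q} \<union> {Suc q..<a}"
        using False Suc.prems(3,4) by (cases x q rule: linorder_cases) auto
    qed
    then have "card J = card ({x \<in> J. x < q} \<union> {Suc q..<a})" by (rule arg_cong)
    also have "\<dots> = card {x \<in> J. x < q} + (a - Suc q)"
      using fin by (subst card_Un_disjoint) auto
    also have "card {x \<in> J. x < q} = pos (insert q J) q"
      unfolding pos_def by (intro arg_cong[of _ _ card]) auto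
    finally have cJ: "card J = pos (insert q J) q + (a - 1 - q)" by simp
    have "minor h (insert N R) (insert q J) = (\<Sum>j\<in>insert q J. (-1) ^ (pos (insert N R) N + pos (insert q J) j) * h N j *
        minor h (insert N R - {N}) (insert q J - {j}))"
      by (rule minor_expand_row) (use fin NR False Suc.prems in auto)
    also have "\<dots> = (\<Sum>j\<in>insert q J. if j = q then (-1) ^ (pos (insert N R) N + pos (insert q J) q) * (-1) ^ (a - 1 - q) *
        minor h R J else 0)"
      using NR False by (intro sum.cong refl) (auto simp: hN)
    also have "\<dots> = (-1) ^ (card J + (pos (insert q J) q + (a - 1 - q))) * minor h R J"
      using fin by (simp add: pN power_add)
    also have "\<dots> = minor h R J" unfolding cJ[symmetric] by (simp add: power_add[symmetric])
    finally show ?thesis using R' by auto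
  qed
qed

text \<open>Once the appended block is normalised, the first n rows are coordinates in an affine
  chart of a Grassmannian, where minors of all sizes are Plucker coordinates up to sign; the signs
  in \<open>W\<close> absorb that sign.\<close>

lemma max_minors_pos_imp_TP:
  assumes pos: "max_minors_pos n a f" and an: "a \<le> n"
  obtains M where "M \<in> carrier_mat a a" "TP n a (\<lambda>i j. \<Sum>c<a. f i c * M $$ (c, j))"
proof -
  obtain h where h: "max_minors_pos (n + a) a h" "\<forall>i<n. \<forall>j. h i j = f i j"
    using max_minors_pos_append_rows[OF pos an] by blast
  define B where "B = mat a a (\<lambda>(r, c). h (n + r) c)"
  have B: "B \<in> carrier_mat a a" unfolding B_def by simp
  have pk: "pick {n..<n + a} r = n + r" if "r < a" for r
  proof -
    have "{x \<in> {n..<n + a}. x < n + r} = {n..<n + r}" using that by auto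
    then have "pos {n..<n + a} (n + r) = r" unfolding pos_def by simp
    then show ?thesis using pick_pos[of "n + r" "{n..<n + a}"] that by simp
  qed
  have detB: "det B = minor h {n..<n + a} {..<a}"
    unfolding minor_def B_def by (intro arg_cong[of _ _ det] eq_matI) (auto simp: pk pick_lessThan)
  have "{n..<n + a} \<subseteq> {..<n + a}" by auto
  then have "minor h {n..<n + a} {..<a} > 0" using h(1) unfolding max_minors_pos_def by simp
  then have "det B \<noteq> 0" unfolding detB by simp
  define W where "W = mat a a (\<lambda>(r, c). if r + c = a - 1 then (-1) ^ r else (0::real))"
  have W: "W \<in> carrier_mat a a" unfolding W_def by simp
  \<comment> \<open>\<open>M\<close> is the inverse of \<open>B\<close> times \<open>W\<close>, so
    that it turns the appended block into \<open>W\<close>.\<close>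
  define M where "M = adj_mat B * (inverse (det B) \<cdot>\<^sub>m W)"
  have adj: "adj_mat B \<in> carrier_mat a a" "B * adj_mat B = det B \<cdot>\<^sub>m 1\<^sub>m a" using adj_mat[OF B] by auto
  have M: "M \<in> carrier_mat a a" unfolding M_def using adj W by simp
  have "B * M = (B * adj_mat B) * (inverse (det B) \<cdot>\<^sub>m W)"
    unfolding M_def using adj B W by (intro assoc_mult_mat[symmetric]) auto
  also have "\<dots> = W" unfolding adj(2) using \<open>det B \<noteq> 0\<close> W
    by (subst mult_smult_assoc_mat[of _ a a _ a]) (auto intro!: eq_matI)
  finally have BM: "B * M = W" .
  define h' where "h' = (\<lambda>i j. \<Sum>c<a. h i c * M $$ (c, j))"
  have minor_h': "minor h' R {..<a} = minor h R {..<a} * det M" if "finite R" "card R = a" for R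
    by (rule minor_mult[OF that M]) (simp add: h'_def)
  have W_h': "h' (n + r) c = (if r + c = a - 1 then (-1) ^ r else 0)" if rc: "r < a" "c < a" for r c
  proof -
    have "(B * M) $$ (r, c) = (\<Sum>d\<in>{0..<a}. h (n + r) d * M $$ (d, c))"
      using rc M by (simp add: scalar_prod_def B_def)
    then have "h' (n + r) c = W $$ (r, c)" unfolding h'_def BM by (simp add: atLeast0LessThan)
    then show ?thesis using rc by (simp add: W_def)
  qed
  have key: "\<exists>R'\<subseteq>{..<n + a}. card R' = a \<and> minor h' R J = minor h R' {..<a} * det M"
    if RJ: "R \<subseteq> {..<n}" "J \<subseteq> {..<a}" "card R = card J" for R J
  proof -
    obtain R' where "R' \<subseteq> {..<n + a}" "card R' = a" "minor h' R J = minor h' R' {..<a}"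
      using minor_eq_maximal_minor[of a h' n a R J, OF W_h'] RJ by auto
    then show ?thesis using minor_h'[of R'] finite_subset by auto
  qed
  have hpos: "minor h R' {..<a} > 0" if "R' \<subseteq> {..<n + a}" "card R' = a" for R'
    using h(1) that unfolding max_minors_pos_def by auto
  \<comment> \<open>The empty minor equals 1 and is also a positive maximal minor times
    \<open>det M\<close>.\<close>
  have detM: "det M > 0"
  proof -
    obtain R' where R': "R' \<subseteq> {..<n + a}" "card R' = a" "minor h' {} {} = minor h R' {..<a} * det M"
      using key[of "{}" "{}"] by auto
    then show ?thesis using hpos[OF R'(1,2)] zero_less_mult_pos[of "minor h R' {..<a}" "det M"] by simp
  qed
  have "minor h' I J > 0" if IJ: "I \<subseteq> {..<n}" "J \<subseteq> {..<a}" "card I = card J" for I J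
  proof -
    obtain R' where "R' \<subseteq> {..<n + a}" "card R' = a" "minor h' I J = minor h R' {..<a} * det M"
      using key[OF IJ] by blast
    then show ?thesis using hpos detM by simp
  qed
  then have "TP n a h'" unfolding TP_def by blast
  moreover have "minor (\<lambda>i j. \<Sum>c<a. f i c * M $$ (c, j)) I J = minor h' I J" if "I \<subseteq> {..<n}" "J \<subseteq> {..<a}" for I J
  proof (rule minor_cong)
    show "finite I" "finite J" using that by (meson finite_subset finite_lessThan)+
  qed (use that h(2) in \<open>auto simp: h'_def intro!: sum.cong\<close>)
  ultimately have "TP n a (\<lambda>i j. \<Sum>c<a. f i c * M $$ (c, j))" unfolding TP_def by auto
  then show thesis using that M by blast
qed

text \<open>The bound \<open>max a (Suc j)\<close> is what preserves the flag: the first a columns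
  may mix among themselves, while a column j >= a uses only columns 0 to j. So for each k from a to
  b the first k new columns stay in the old span.\<close>

lemma minors_pos_imp_TP:
  assumes ab: "a \<le> b" "b \<le> n" and pos: "\<And>k. k \<in> {a..b} \<Longrightarrow> max_minors_pos n k f"
  shows "\<exists>h. TP n b h \<and> (\<forall>j<b. \<exists>x. \<forall>i<n. h i j = (\<Sum>c<max a (Suc j). x c * f i c))"
  using ab
proof (induction b rule: dec_induct)
  case base
  obtain M where M: "TP n a (\<lambda>i j. \<Sum>c<a. f i c * M $$ (c, j))"
    using max_minors_pos_imp_TP[of n a f] pos[of a] ab by auto
  have "\<exists>x. \<forall>i<n. (\<Sum>c<a. f i c * M $$ (c, j)) = (\<Sum>c<max a (Suc j). x c * f i c)" if "j < a" for j
  proof -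
    have "max a (Suc j) = a" using that by simp
    then show ?thesis by (intro exI[of _ "\<lambda>c. M $$ (c, j)"]) (simp add: mult.commute)
  qed
  then show ?case using M by blast
next
  case (step m)
  then obtain h where h: "TP n m h" and dep: "\<forall>j<m. \<exists>x. \<forall>i<n. h i j = (\<Sum>c<max a (Suc j). x c * f i c)"
    by auto
  have "\<exists>x. \<forall>i<n. h i j = (\<Sum>c<m. x c * f i c)" if j: "j < m" for j
  proof -
    obtain x where x: "\<forall>i<n. h i j = (\<Sum>c<max a (Suc j). x c * f i c)" using dep j by blast
    have "(\<Sum>c<max a (Suc j). x c * f i c) = (\<Sum>c<m. (if c < max a (Suc j) then x c else 0) * f i c)" for i
      using j step.hyps by (intro sum.mono_neutral_cong_left) auto
    then show ?thesis using x by auto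
  qed
  then obtain X where X: "\<And>i j. i < n \<Longrightarrow> j < m \<Longrightarrow> h i j = (\<Sum>c<m. X j c * f i c)" by metis
  define M where "M = mat m m (\<lambda>(c, j). X j c)"
  have M: "M \<in> carrier_mat m m" unfolding M_def by simp
  have minor_h: "minor h I {..<m} = minor f I {..<m} * det M" if "I \<subseteq> {..<n}" "card I = m" for I
    using that finite_subset by (intro minor_mult[OF _ _ M]) (auto simp: X M_def mult_ac intro!: sum.cong)
  have "minor h {..<m} {..<m} > 0" using step.hyps step.prems by (intro TP_D[OF h]) auto
  moreover have "minor f {..<m} {..<m} > 0"
  proof -
    have "{..<m} \<subseteq> {..<n}" using step by auto
    then show ?thesis using pos[of m] step unfolding max_minors_pos_def by auto
  qed
  moreover have "{..<m} \<subseteq> {..<n}" using step by auto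
  \<comment> \<open>\<open>h\<close> and \<open>f\<close> both have a positive minor in the first m
    rows and columns, and \<open>M\<close> relates the two.\<close>
  ultimately have detM: "det M > 0" using minor_h[of "{..<m}"] by (auto simp: zero_less_mult_iff)
  \<comment> \<open>With column m of \<open>f\<close> next to the modified columns, the minors of
    size m + 1 are those of \<open>f\<close> times \<open>det M\<close>.\<close>
  have full: "minor (col_upd h m (\<lambda>i. f i m)) I {..<Suc m} > 0" if I: "I \<subseteq> {..<n}" "card I = Suc m" for I
  proof -
    have fin: "finite I" using I finite_subset by auto
    have "minor (col_upd h m (\<lambda>i. f i m)) I {..<Suc m} =
       (\<Sum>i\<in>I. (-1) ^ (pos I i + pos {..<Suc m} m) * f i m * minor h (I - {i}) ({..<Suc m} - {m}))"
      using I fin by (subst minor_col_upd_expand) auto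
    also have "\<dots> = (\<Sum>i\<in>I. det M * ((-1) ^ (pos I i + pos {..<Suc m} m) * f i m * minor f (I - {i}) ({..<Suc m} - {m})))"
    proof (rule sum.cong[OF refl])
      fix i assume i: "i \<in> I"
      have "minor h (I - {i}) {..<m} = minor f (I - {i}) {..<m} * det M"
        using i I fin by (intro minor_h) auto
      moreover have "{..<Suc m} - {m} = {..<m}" by auto
      ultimately show "(-1) ^ (pos I i + pos {..<Suc m} m) * f i m * minor h (I - {i}) ({..<Suc m} - {m}) =
        det M * ((-1) ^ (pos I i + pos {..<Suc m} m) * f i m * minor f (I - {i}) ({..<Suc m} - {m}))" by simp
    qed
    also have "\<dots> = det M * minor f I {..<Suc m}"
      using I fin by (subst minor_expand_col[of I "{..<Suc m}" m f]) (auto simp: sum_distrib_left)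
    also have "\<dots> > 0" using detM pos[of "Suc m"] step I unfolding max_minors_pos_def by auto
    finally show ?thesis .
  qed
  obtain s where s: "TP n (Suc m) (col_upd h m (alt_comb h m (\<lambda>i. f i m) s))"
    by (rule TP_alt_comb[OF h full])
  have "\<exists>x. \<forall>i<n. alt_comb h m (\<lambda>i. f i m) s i = (\<Sum>c<Suc m. x c * f i c)"
  proof (intro exI allI impI)
    fix i assume i: "i < n"
    have "(\<Sum>c<m. (-s) ^ (m - 1 - c) * h i c) = (\<Sum>d<m. (\<Sum>c<m. (-s) ^ (m - 1 - c) * X c d) * f i d)"
      unfolding sum_distrib_right by (subst sum.swap) (simp add: X[OF i] sum_distrib_left mult_ac)
    then show "alt_comb h m (\<lambda>i. f i m) s i =
       (\<Sum>c<Suc m. (if c = m then s ^ m else (\<Sum>c'<m. (-s) ^ (m - 1 - c') * X c' c)) * f i c)"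
      unfolding alt_comb_def by simp
  qed
  moreover have "max a (Suc m) = Suc m" using step by simp
  ultimately have "\<exists>x. \<forall>i<n. col_upd h m (alt_comb h m (\<lambda>i. f i m) s) i j = (\<Sum>c<max a (Suc j). x c * f i c)"
    if "j < Suc m" for j
    using dep that by (cases "j = m") (auto simp: col_upd_def less_Suc_eq)
  then show ?case using s by blast
qed

section \<open>Column spans and flags\<close>

abbreviation ent :: "'a mat \<Rightarrow> nat \<Rightarrow> nat \<Rightarrow> 'a" where
  "ent A \<equiv> \<lambda>i j. A $$ (i, j)"

lemma right_inverse_mat_exists:
  fixes A :: "'a::field mat"
  assumes A: "A \<in> carrier_mat n n" and "det A \<noteq> 0"
  obtains B where "B \<in> carrier_mat n n" "A * B = 1\<^sub>m n" "B * A = 1\<^sub>m n"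
proof -
  define B where "B = inverse (det A) \<cdot>\<^sub>m adj_mat A"
  have adj: "adj_mat A \<in> carrier_mat n n" "A * adj_mat A = det A \<cdot>\<^sub>m 1\<^sub>m n" "adj_mat A * A = det A \<cdot>\<^sub>m 1\<^sub>m n"
    using adj_mat[OF A] by auto
  have B: "B \<in> carrier_mat n n" unfolding B_def using adj by simp
  have "A * B = inverse (det A) \<cdot>\<^sub>m (A * adj_mat A)"
    unfolding B_def using A adj by (intro mult_smult_distrib) auto
  also have "\<dots> = 1\<^sub>m n" unfolding adj(2) using assms by (intro eq_matI) auto
  finally have AB: "A * B = 1\<^sub>m n" .
  have "B * A = inverse (det A) \<cdot>\<^sub>m (adj_mat A * A)"
    unfolding B_def using A adj by (intro mult_smult_assoc_mat) auto
  also have "\<dots> = 1\<^sub>m n" unfolding adj(3) using assms by (intro eq_matI) auto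
  finally show thesis using that B AB by blast
qed

lemma invertible_mat_iff_det:
  fixes A :: "'a::field mat"
  assumes A: "A \<in> carrier_mat n n"
  shows "invertible_mat A \<longleftrightarrow> det A \<noteq> 0"
proof
  assume "invertible_mat A"
  then obtain B where "A * B = 1\<^sub>m (dim_row A)" "B * A = 1\<^sub>m (dim_row B)"
    unfolding invertible_mat_def inverts_mat_def by auto
  then have AB: "A * B = 1\<^sub>m n" and BA: "B * A = 1\<^sub>m (dim_row B)" using A by auto
  have "dim_col B = n" using arg_cong[OF AB, of dim_col] by simp
  moreover have "dim_row B = n" using arg_cong[OF BA, of dim_col] A by simp
  ultimately have "B \<in> carrier_mat n n" by auto
  then have "det A * det B = 1" using det_mult[OF A, of B] AB by simp
  then show "det A \<noteq> 0" by auto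
next
  assume "det A \<noteq> 0"
  then obtain B where "B \<in> carrier_mat n n" "A * B = 1\<^sub>m n" "B * A = 1\<^sub>m n"
    using right_inverse_mat_exists[OF A] by blast
  then show "invertible_mat A" using A unfolding invertible_mat_def inverts_mat_def by auto
qed

lemma GL_iff_minor: "g \<in> GL n \<longleftrightarrow> g \<in> carrier_mat n n \<and> minor (ent g) {..<n} {..<n} \<noteq> 0"
  unfolding GL_def by (auto simp: invertible_mat_iff_det det_minor)

definition first_cols :: "nat \<Rightarrow> 'a mat \<Rightarrow> nat \<Rightarrow> 'a mat" where
  "first_cols n A k = mat n k (\<lambda>(i, j). A $$ (i, j))"

lemma first_cols_carrier [simp]: "first_cols n A k \<in> carrier_mat n k"
  unfolding first_cols_def by simp

lemma col_first_cols: "dim_row A = n \<Longrightarrow> k \<le> dim_col A \<Longrightarrow> j < k \<Longrightarrow> col (first_cols n A k) j = col A j"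
  unfolding first_cols_def by (intro eq_vecI) auto

lemma set_cols_first_cols:
  assumes "dim_row A = n" "k \<le> dim_col A"
  shows "set (cols (first_cols n A k)) = col A ` {..<k}"
proof -
  have "set (cols (first_cols n A k)) = col (first_cols n A k) ` {..<k}"
    unfolding cols_def first_cols_def by (simp add: atLeast0LessThan)
  then show ?thesis using col_first_cols[OF assms] by (simp cong: image_cong_simp)
qed

lemma col_span_first_cols:
  assumes "dim_row A = n" "k \<le> dim_col A"
  shows "col_span n A k = LinearCombinations.module.span class_ring (Rspace n) (set (cols (first_cols n A k)))"
  unfolding col_span_def set_cols_first_cols[OF assms] ..

lemma in_col_span_iff:
  assumes A: "dim_row A = n" "k \<le> dim_col A"
  shows "v \<in> col_span n A k \<longleftrightarrow> v \<in> carrier_vec n \<and> (\<exists>x. \<forall>i<n. v $ i = (\<Sum>c<k. A $$ (i, c) * x c))"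
proof -
  interpret V: vec_space "TYPE(real)" n .
  have mv: "(first_cols n A k *\<^sub>v x) $ i = (\<Sum>c<k. A $$ (i, c) * x $ c)" if "i < n" "x \<in> carrier_vec k" for i x
    using that unfolding first_cols_def by (simp add: scalar_prod_def row_def atLeast0LessThan)
  have "col_span n A k = V.col_space (first_cols n A k)"
    unfolding col_span_first_cols[OF A] V.col_space_def Rspace_def ..
  also have "\<dots> = {y \<in> carrier_vec n. \<exists>x\<in>carrier_vec k. first_cols n A k *\<^sub>v x = y}"
    using V.col_space_eq[OF first_cols_carrier, of A k] by (simp add: first_cols_def)
  finally have *: "v \<in> col_span n A k \<longleftrightarrow> v \<in> carrier_vec n \<and> (\<exists>x\<in>carrier_vec k. first_cols n A k *\<^sub>v x = v)" by simp
  show ?thesis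
  proof
    assume "v \<in> col_span n A k"
    then show "v \<in> carrier_vec n \<and> (\<exists>x. \<forall>i<n. v $ i = (\<Sum>c<k. A $$ (i, c) * x c))"
      unfolding * using mv by metis
  next
    assume "v \<in> carrier_vec n \<and> (\<exists>x. \<forall>i<n. v $ i = (\<Sum>c<k. A $$ (i, c) * x c))"
    then obtain x where v: "v \<in> carrier_vec n" and x: "\<forall>i<n. v $ i = (\<Sum>c<k. A $$ (i, c) * x c)" by blast
    have "first_cols n A k *\<^sub>v vec k x = v"
      using v x mv[of _ "vec k x"] by (intro eq_vecI) (auto simp: first_cols_def)
    then show "v \<in> col_span n A k" unfolding * using v by (metis vec_carrier)
  qed
qed

lemma col_in_col_span:
  assumes "dim_row A = n" "k \<le> dim_col A" "j < k"
  shows "col A j \<in> col_span n A k"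
  unfolding in_col_span_iff[OF assms(1,2)]
proof (intro conjI exI allI impI)
  fix i assume "i < n"
  have "(\<Sum>c<k. A $$ (i, c) * (if c = j then 1 else 0)) = (\<Sum>c<k. if c = j then A $$ (i, c) else 0)"
    by (intro sum.cong) auto
  then show "col A j $ i = (\<Sum>c<k. A $$ (i, c) * (if c = j then 1 else 0))"
    using assms \<open>i < n\<close> by simp
qed (use assms in auto)

lemma col_span_subset_imp_mult:
  assumes A: "dim_row A = n" "k \<le> dim_col A" and B: "dim_row B = n" "k \<le> dim_col B"
    and sub: "col_span n A k \<subseteq> col_span n B k"
  obtains M where "M \<in> carrier_mat k k" "\<And>i j. i < n \<Longrightarrow> j < k \<Longrightarrow> A $$ (i, j) = (\<Sum>c<k. B $$ (i, c) * M $$ (c, j))"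
proof -
  have "\<exists>x. \<forall>i<n. A $$ (i, j) = (\<Sum>c<k. B $$ (i, c) * x c)" if j: "j < k" for j
  proof -
    have "col A j \<in> col_span n B k" using col_in_col_span[OF A j] sub by blast
    then obtain x where "\<forall>i<n. col A j $ i = (\<Sum>c<k. B $$ (i, c) * x c)"
      unfolding in_col_span_iff[OF B] by blast
    then show ?thesis using A j by auto
  qed
  then obtain X where X: "\<And>i j. i < n \<Longrightarrow> j < k \<Longrightarrow> A $$ (i, j) = (\<Sum>c<k. B $$ (i, c) * X j c)" by metis
  show thesis
  proof (rule that[of "mat k k (\<lambda>(c, j). X j c)"])
    fix i j assume "i < n" "j < k"
    then show "A $$ (i, j) = (\<Sum>c<k. B $$ (i, c) * mat k k (\<lambda>(c, j). X j c) $$ (c, j))"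
      using X by simp
  qed simp
qed

lemma col_span_mult_subset:
  assumes A: "dim_row A = n" "k \<le> dim_col A" and B: "dim_row B = n" "k \<le> dim_col B"
    and M: "\<And>i j. i < n \<Longrightarrow> j < k \<Longrightarrow> A $$ (i, j) = (\<Sum>c<k. B $$ (i, c) * M c j)"
  shows "col_span n A k \<subseteq> col_span n B k"
proof
  fix v assume "v \<in> col_span n A k"
  then obtain x where v: "v \<in> carrier_vec n" and x: "\<forall>i<n. v $ i = (\<Sum>c<k. A $$ (i, c) * x c)"
    unfolding in_col_span_iff[OF A] by blast
  have "v $ i = (\<Sum>d<k. B $$ (i, d) * (\<Sum>c<k. M d c * x c))" if i: "i < n" for i
  proof -
    have "v $ i = (\<Sum>c<k. \<Sum>d<k. B $$ (i, d) * M d c * x c)"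
      using x i by (simp add: M sum_distrib_right)
    also have "\<dots> = (\<Sum>d<k. B $$ (i, d) * (\<Sum>c<k. M d c * x c))"
      by (subst sum.swap) (simp add: sum_distrib_left mult.assoc)
    finally show ?thesis .
  qed
  then show "v \<in> col_span n B k"
    unfolding in_col_span_iff[OF B] using v by (intro conjI exI[of _ "\<lambda>d. \<Sum>c<k. M d c * x c"]) auto
qed

lemma col_span_mult_eq:
  assumes A: "dim_row A = n" "k \<le> dim_col A" and B: "dim_row B = n" "k \<le> dim_col B"
    and M: "M \<in> carrier_mat k k" "det M \<noteq> 0"
    and AB: "\<And>i j. i < n \<Longrightarrow> j < k \<Longrightarrow> A $$ (i, j) = (\<Sum>c<k. B $$ (i, c) * M $$ (c, j))"
  shows "col_span n A k = col_span n B k"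
proof
  show "col_span n A k \<subseteq> col_span n B k" by (rule col_span_mult_subset[OF A B AB])
  obtain N where N: "N \<in> carrier_mat k k" "M * N = 1\<^sub>m k" using right_inverse_mat_exists[OF M] by blast
  have MN: "(\<Sum>c<k. M $$ (d, c) * N $$ (c, j)) = (if d = j then 1 else 0)" if "d < k" "j < k" for d j
  proof -
    have "(M * N) $$ (d, j) = (\<Sum>c<k. M $$ (d, c) * N $$ (c, j))"
      using that M(1) N(1) by (simp add: scalar_prod_def atLeast0LessThan)
    moreover have "(M * N) $$ (d, j) = (if d = j then 1 else 0)" unfolding N(2) using that by simp
    ultimately show ?thesis by (rule trans[OF sym])
  qed
  show "col_span n B k \<subseteq> col_span n A k"
  proof (rule col_span_mult_subset[OF B A])
    fix i j assume ij: "i < n" "j < k"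
    have "(\<Sum>c<k. A $$ (i, c) * N $$ (c, j)) = (\<Sum>c<k. \<Sum>d<k. B $$ (i, d) * M $$ (d, c) * N $$ (c, j))"
      using ij by (simp add: AB sum_distrib_right)
    also have "\<dots> = (\<Sum>d<k. B $$ (i, d) * (\<Sum>c<k. M $$ (d, c) * N $$ (c, j)))"
      by (subst sum.swap) (simp add: sum_distrib_left mult.assoc)
    also have "\<dots> = (\<Sum>d<k. if d = j then B $$ (i, d) else 0)"
      using ij by (intro sum.cong) (auto simp: MN)
    also have "\<dots> = B $$ (i, j)" using ij by simp
    finally show "B $$ (i, j) = (\<Sum>c<k. A $$ (i, c) * N $$ (c, j))" by simp
  qed
qed

text \<open>Plucker coordinates of a subspace are well defined up to a scalar: \<open>d\<close> is
  the determinant of the change of basis.\<close>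

lemma col_span_eq_imp_minor_mult:
  assumes A: "dim_row A = n" "k \<le> dim_col A" and B: "dim_row B = n" "k \<le> dim_col B"
    and sub: "col_span n A k = col_span n B k"
  obtains d where "\<And>I. I \<subseteq> {..<n} \<Longrightarrow> card I = k \<Longrightarrow> minor (ent A) I {..<k} = minor (ent B) I {..<k} * d"
proof -
  obtain M where M: "M \<in> carrier_mat k k" "\<And>i j. i < n \<Longrightarrow> j < k \<Longrightarrow> A $$ (i, j) = (\<Sum>c<k. B $$ (i, c) * M $$ (c, j))"
    by (rule col_span_subset_imp_mult[OF A B equalityD1[OF sub]]) auto
  have "minor (ent A) I {..<k} = minor (ent B) I {..<k} * det M" if I: "I \<subseteq> {..<n}" "card I = k" for I
  proof (rule minor_mult[OF _ I(2) M(1)])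
    show "finite I" using I finite_subset by auto
  qed (use I M(2) in auto)
  then show thesis by (rule that)
qed

text \<open>Border a nonvanishing minor of largest size r < k by a further column \<open>c\<close>.
  The cofactors along the bordering row form the relation: each bordered determinant vanishes, by a
  repeated row or by maximality of r, and the coefficient of \<open>c\<close> is the chosen minor up
  to sign.\<close>

lemma vanishing_minors_imp_relation:
  fixes f :: "nat \<Rightarrow> nat \<Rightarrow> 'a::idom"
  assumes van: "\<And>I. I \<subseteq> {..<n} \<Longrightarrow> card I = k \<Longrightarrow> minor f I {..<k} = 0"
  obtains x c where "c < k" "x c \<noteq> 0" "\<forall>i<n. (\<Sum>j<k. f i j * x j) = 0"
proof -
  define P where "P r \<longleftrightarrow> (\<exists>I J. I \<subseteq> {..<n} \<and> J \<subseteq> {..<k} \<and> card I = r \<and> card J = r \<and> minor f I J \<noteq> 0)" for r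
  have P0: "P 0" unfolding P_def by (intro exI[of _ "{}"]) auto
  have bound: "r \<le> k" if Pr: "P r" for r
  proof -
    obtain J where "J \<subseteq> {..<k}" "card J = r" using Pr unfolding P_def by blast
    then show ?thesis using card_mono[of "{..<k}" J] by simp
  qed
  define r where "r = Greatest P"
  have Pr: "P r" unfolding r_def by (rule GreatestI_nat[where P = P, OF P0 bound])
  have max: "\<not> P (Suc r)"
  proof
    assume "P (Suc r)"
    then have "Suc r \<le> r" unfolding r_def by (rule Greatest_le_nat[where P = P]) (rule bound)
    then show False by simp
  qed
  obtain I J where IJ: "I \<subseteq> {..<n}" "J \<subseteq> {..<k}" "card I = r" "card J = r" "minor f I J \<noteq> 0"
    using Pr unfolding P_def by blast
  have fin: "finite I" "finite J" using IJ by (meson finite_subset finite_lessThan)+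
  have "J \<noteq> {..<k}" using van[of I] IJ by auto
  then obtain c where c: "c < k" "c \<notin> J" using IJ by auto
  define ft where "ft = (\<lambda>j i. f i j)"
  \<comment> \<open>The index n lies outside \<open>I\<close> and stands for the bordering row, into
    which row \<open>i\<close> of \<open>f\<close> is copied.\<close>
  define x where "x j = (if j \<in> insert c J then (-1) ^ (pos (insert c J) j + pos (insert n I) n) *
     minor ft (insert c J - {j}) I else 0)" for j
  have "minor ft J I = minor f I J" unfolding ft_def using IJ by (intro minor_transpose) simp
  then have xc: "x c \<noteq> 0" unfolding x_def using c IJ by simp
  have "(\<Sum>j<k. f i j * x j) = 0" if i: "i < n" for i
  proof -
    have nI: "n \<notin> I" using IJ by auto
    have "(\<Sum>j<k. f i j * x j) = (\<Sum>j\<in>insert c J. f i j * x j)"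
      using IJ c by (intro sum.mono_neutral_right) (auto simp: x_def)
    also have "\<dots> = (\<Sum>j\<in>insert c J. (-1) ^ (pos (insert c J) j + pos (insert n I) n) * ft j i *
        minor ft (insert c J - {j}) (insert n I - {n}))"
      using nI by (intro sum.cong) (auto simp: x_def ft_def)
    also have "\<dots> = minor (col_upd ft n (\<lambda>j. ft j i)) (insert c J) (insert n I)"
      using fin IJ c nI by (intro minor_col_upd_expand[symmetric]) auto
    also have "\<dots> = (if i \<in> I then 0 else (-1) ^ card {j \<in> I. i < j} * minor ft (insert c J) (insert i I))"
      using fin IJ c by (intro minor_col_upd_copy) auto
    also have "\<dots> = 0"
    proof (cases "i \<in> I")
      case False
      then have ci: "card (insert i I) = Suc r" "card (insert c J) = Suc r" using IJ c fin by auto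
      have "insert i I \<subseteq> {..<n}" "insert c J \<subseteq> {..<k}" using IJ c i by auto
      then have "minor f (insert i I) (insert c J) = 0"
        using max ci unfolding P_def by blast
      then have "minor ft (insert c J) (insert i I) = 0"
        unfolding ft_def using ci minor_transpose[of "insert i I" "insert c J" f] by simp
      then show ?thesis by simp
    qed simp
    finally show ?thesis .
  qed
  then show thesis using that c xc by blast
qed

section \<open>Dimensions of column spans and nonvanishing minors\<close>

lemma dim_col_span:
  assumes "dim_row A = n" "k \<le> dim_col A"
  shows "vectorspace.dim class_ring (Rspace n\<lparr>carrier := col_span n A k\<rparr>) = vec_space.rank n (first_cols n A k)"
proof -
  interpret V: vec_space "TYPE(real)" n .
  show ?thesis unfolding V.rank_def col_span_first_cols[OF assms] Rspace_def ..
qed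

lemma rank_full_imp_minor:
  fixes A :: "real mat"
  assumes A: "dim_row A = n" "k \<le> dim_col A"
    and rank: "vec_space.rank n (first_cols n A k) = k"
  shows "\<exists>I. I \<subseteq> {..<n} \<and> card I = k \<and> minor (ent A) I {..<k} \<noteq> 0"
proof (rule ccontr)
  interpret V: vec_space "TYPE(real)" n .
  define F where "F = first_cols n A k"
  have F: "F \<in> carrier_mat n k" unfolding F_def by simp
  assume "\<not> ?thesis"
  then have "minor (ent A) I {..<k} = 0" if "I \<subseteq> {..<n}" "card I = k" for I using that by blast
  then obtain x c where x: "c < k" "x c \<noteq> 0" "\<forall>i<n. (\<Sum>j<k. A $$ (i, j) * x j) = 0"
    by (rule vanishing_minors_imp_relation)
  have "F *\<^sub>v vec k x = 0\<^sub>v n"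
    using x(3) by (intro eq_vecI) (auto simp: F_def first_cols_def scalar_prod_def row_def atLeast0LessThan)
  moreover have "vec k x \<noteq> 0\<^sub>v k"
  proof
    assume "vec k x = 0\<^sub>v k"
    then have "vec k x $ c = 0" using x(1) by simp
    then show False using x by simp
  qed
  ultimately have dep: "distinct (cols F) \<Longrightarrow> V.lin_dep (set (cols F))"
    using V.lin_depI[OF F, of "vec k x"] by simp
  have rk: "V.rank F = k" using rank unfolding F_def .
  \<comment> \<open>A set of columns forgets repetitions. Distinct dependent columns contradict full
    rank; repeated ones leave fewer than k vectors, which is excluded below.\<close>
  have "\<not> distinct (cols F)" using dep V.full_rank_lin_indpt[OF F rk] by blast
  then have "card (set (cols F)) < k"
    using F card_distinct[of "cols F"] card_length[of "cols F"] by (auto simp: le_less)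
  moreover obtain S where S: "maximal S (\<lambda>T. T \<subseteq> set (cols F) \<and> V.lin_indpt T)"
    using maximal_exists[of "(\<lambda>T. T \<subseteq> set (cols F) \<and> V.lin_indpt T)" "card (set (cols F))" "{}"]
    by (meson List.finite_set card_mono empty_iff empty_subsetI V.finite_lin_indpt2 rev_finite_subset)
  then have "card S \<le> card (set (cols F))" by (simp add: card_mono maximal_def)
  ultimately show False using V.rank_card_indpt[OF F S] rk by simp
qed

lemma rank_first_cols_GL:
  assumes g: "g \<in> GL n" and k: "k \<le> n"
  shows "vec_space.rank n (first_cols n g k) = k"
proof -
  interpret V: vec_space "TYPE(real)" n .
  have gc: "g \<in> carrier_mat n n" and det: "det g \<noteq> 0"
    using g invertible_mat_iff_det unfolding GL_def by auto
  have d: "dim_row g = n" "k \<le> dim_col g" using gc k by auto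
  have sub: "set (cols (first_cols n g k)) \<subseteq> set (cols g)"
    unfolding set_cols_first_cols[OF d] using k gc by (auto simp: cols_def)
  have "V.lin_indpt (set (cols g))" using V.lin_dep_cols_imp_det_0[OF gc] det by blast
  then have li: "V.lin_indpt (set (cols (first_cols n g k)))" using V.subset_li_is_li sub by blast
  have "cols (first_cols n g k) ! i \<noteq> cols (first_cols n g k) ! j" if ij: "i < k" "j < k" "i \<noteq> j" for i j
  proof -
    have "col g i \<noteq> col g j" using det_identical_columns[OF gc ij(3)] ij k det by auto
    moreover have "cols (first_cols n g k) ! i = col g i" "cols (first_cols n g k) ! j = col g j"
      using ij col_first_cols[OF d] by (simp_all add: cols_def first_cols_def)
    ultimately show ?thesis by simp
  qed
  then have "distinct (cols (first_cols n g k))"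
    unfolding distinct_conv_nth by (simp add: first_cols_def)
  then show ?thesis by (rule V.lin_indpt_full_rank[OF first_cols_carrier _ li])
qed

lemma flag_of_in_flags:
  assumes g: "g \<in> GL n" and K: "K \<subseteq> {..n}"
  shows "flag_of K n g \<in> flags K n"
proof -
  interpret V: vec_space "TYPE(real)" n .
  have gc: "dim_row g = n" "dim_col g = n" using g unfolding GL_def by auto
  have dim: "vectorspace.dim class_ring (Rspace n\<lparr>carrier := col_span n g k\<rparr>) = k" if "k \<in> K" for k
    using dim_col_span[OF gc(1), of k] rank_first_cols_GL[OF g, of k] that K gc by auto
  have "col g ` {..<k} \<subseteq> carrier_vec n" for k using gc by auto
  then have sub: "VectorSpace.subspace class_ring (col_span n g k) (Rspace n)" for k
    unfolding col_span_def Rspace_def by (intro V.span_is_subspace) simp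
  have mono: "col_span n g j \<subseteq> col_span n g k" if "j < k" for j k
    unfolding col_span_def Rspace_def using that by (intro V.span_is_monotone) auto
  have strict: "col_span n g j \<subset> col_span n g k" if "j \<in> K" "k \<in> K" "j < k" for j k
    using mono[OF that(3)] dim[OF that(1)] dim[OF that(2)] that(3) by (metis less_irrefl psubsetI)
  show ?thesis unfolding flags_def flag_of_def using dim sub strict by auto
qed

lemma flags_imp_minor:
  assumes V: "V \<in> flags K n" and rep: "represents K n A V" and k: "k \<in> K"
  obtains I where "I \<subseteq> {..<n}" "card I = k" "minor (ent A) I {..<k} \<noteq> 0"
proof -
  have A: "dim_row A = n" "k \<le> dim_col A" "V k = col_span n A k" using rep k unfolding represents_def by auto
  have "vectorspace.dim class_ring (Rspace n\<lparr>carrier := V k\<rparr>) = k" using V k unfolding flags_def by auto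
  then have "vec_space.rank n (first_cols n A k) = k" unfolding A(3) dim_col_span[OF A(1,2)] .
  then show thesis using rank_full_imp_minor[OF A(1,2)] that by blast
qed

text \<open>Append unit vectors supported in rows outside \<open>I\<close>, one at a time: the
  expansion along such a column has one nonzero term, the previous minor up to sign.\<close>

lemma extend_to_invertible:
  fixes f :: "nat \<Rightarrow> nat \<Rightarrow> 'a::idom"
  assumes "b \<le> n" "I \<subseteq> {..<n}" "card I = b" "minor f I {..<b} \<noteq> 0"
  shows "\<exists>h. (\<forall>i. \<forall>j<b. h i j = f i j) \<and> minor h {..<n} {..<n} \<noteq> 0"
  using assms
proof (induction b arbitrary: I f rule: inc_induct)
  case base
  then have "I = {..<n}" by (intro card_subset_eq) auto
  then show ?case using base by auto
next
  case (step b)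
  have fin: "finite I" using step.prems finite_subset by auto
  have "I \<noteq> {..<n}" using step by auto
  then obtain i where i: "i < n" "i \<notin> I" using step.prems by auto
  define h where "h = col_upd f b (\<lambda>i'. if i' = i then 1 else 0)"
  have "minor h (insert i I) {..<Suc b} = (\<Sum>i'\<in>insert i I. (-1) ^ (pos (insert i I) i' + pos {..<Suc b} b) *
      (if i' = i then 1 else 0) * minor f (insert i I - {i'}) ({..<Suc b} - {b}))"
    unfolding h_def using fin i step.prems by (intro minor_col_upd_expand) auto
  also have "\<dots> = (\<Sum>i'\<in>insert i I. if i' = i then (-1) ^ (pos (insert i I) i + pos {..<Suc b} b) *
      minor f (insert i I - {i}) ({..<Suc b} - {b}) else 0)"
    by (intro sum.cong) auto
  also have "\<dots> = (-1) ^ (pos (insert i I) i + pos {..<Suc b} b) * minor f I {..<b}"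
  proof -
    have "insert i I - {i} = I" "{..<Suc b} - {b} = {..<b}" using i by auto
    then show ?thesis using fin by simp
  qed
  finally have "minor h (insert i I) {..<Suc b} \<noteq> 0" using step.prems by simp
  then obtain h' where h': "\<forall>i. \<forall>j<Suc b. h' i j = h i j" "minor h' {..<n} {..<n} \<noteq> 0"
    using step.IH[of "insert i I" h] i step.prems fin by auto
  have "\<forall>i. \<forall>j<b. h' i j = f i j" using h'(1) by (simp add: h_def col_upd_def)
  then show ?case using h'(2) by blast
qed

lemma represents_GL_iff:
  assumes "g \<in> GL n" "K \<subseteq> {..n}" "V \<in> extensional K"
  shows "represents K n g V \<longleftrightarrow> flag_of K n g = V"
proof -
  have g: "dim_row g = n" "\<forall>k\<in>K. k \<le> dim_col g" using assms(1,2) unfolding GL_def by auto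
  have "represents K n g V \<longleftrightarrow> (\<forall>k\<in>K. flag_of K n g k = V k)"
    unfolding represents_def flag_of_def using g by (metis restrict_apply')
  also have "\<dots> \<longleftrightarrow> flag_of K n g = V"
  proof
    assume "\<forall>k\<in>K. flag_of K n g k = V k"
    then show "flag_of K n g = V"
      by (intro extensionalityI[OF _ assms(3)]) (auto simp: flag_of_def)
  qed simp
  finally show ?thesis .
qed

lemma flags_represented_by_GL:
  assumes V: "V \<in> flags K n" and rep: "represents K n A V" and K: "K \<subseteq> {..n}"
  obtains g where "g \<in> GL n" "flag_of K n g = V" "\<And>k i j. k \<in> K \<Longrightarrow> i < n \<Longrightarrow> j < k \<Longrightarrow> g $$ (i, j) = A $$ (i, j)"
proof -
  \<comment> \<open>For empty \<open>K\<close> no column is prescribed, and the extension starts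
    from the empty minor, which is 1.\<close>
  define b where "b = (if K = {} then 0 else Max K)"
  have finK: "finite K" using K finite_subset by auto
  have kb: "k \<le> b" if "k \<in> K" for k using that finK unfolding b_def by auto
  obtain I where I: "b \<le> n" "I \<subseteq> {..<n}" "card I = b" "minor (ent A) I {..<b} \<noteq> 0"
  proof (cases "K = {}")
    case True
    then show ?thesis using that[of "{}"] unfolding b_def by simp
  next
    case False
    then have "b \<in> K" using finK unfolding b_def by simp
    moreover have "b \<le> n" using \<open>b \<in> K\<close> K by auto
    ultimately show ?thesis using flags_imp_minor[OF V rep, of b] that by blast
  qed
  obtain h where h: "\<forall>i. \<forall>j<b. h i j = A $$ (i, j)" "minor h {..<n} {..<n} \<noteq> 0"
    using extend_to_invertible[OF I] by blast
  define g where "g = mat n n (\<lambda>(i, j). h i j)"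
  have gc: "g \<in> carrier_mat n n" unfolding g_def by simp
  have "minor (ent g) {..<n} {..<n} = minor h {..<n} {..<n}" by (rule minor_cong) (auto simp: g_def)
  then have g: "g \<in> GL n" unfolding GL_iff_minor using h gc by simp
  have eq: "g $$ (i, j) = A $$ (i, j)" if "k \<in> K" "i < n" "j < k" for k i j
    using that kb[of k] K h(1) unfolding g_def by auto
  have "col_span n g k = V k" if k: "k \<in> K" for k
  proof -
    have A: "dim_row A = n" "k \<le> dim_col A" "V k = col_span n A k" using rep k unfolding represents_def by auto
    have "col g j = col A j" if "j < k" for j
      using A K k gc that by (intro eq_vecI) (auto simp: eq[OF k])
    then have "col g ` {..<k} = col A ` {..<k}" by (intro image_cong) auto
    then show ?thesis unfolding A(3) col_span_def by simp
  qed
  then have "flag_of K n g = V"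
    using V unfolding flag_of_def flags_def by (intro extensionalityI[of _ K]) auto
  then show thesis using that g eq by blast
qed

section \<open>Consecutive dimensions\<close>

lemma GL_pos_imp_TP:
  assumes "g \<in> GL_pos n"
  shows "TP n n (ent g)"
proof -
  have g: "dim_row g = n" "dim_col g = n" "totally_positive g" using assms unfolding GL_pos_def GL_def by auto
  have "minor (ent g) I J > 0" if "I \<subseteq> {..<n}" "J \<subseteq> {..<n}" "card I = card J" for I J
  proof -
    have "det (submatrix g I J) > 0" using g(3) that unfolding totally_positive_def g(1,2) by blast
    then show ?thesis using that g det_submatrix[of I g J] by simp
  qed
  then show ?thesis unfolding TP_def by blast
qed

lemma TP_imp_GL_pos:
  assumes g: "g \<in> carrier_mat n n" and tp: "TP n n (ent g)"
  shows "g \<in> GL_pos n"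
proof -
  have "minor (ent g) {..<n} {..<n} > 0" by (rule TP_D[OF tp]) auto
  then have "g \<in> GL n" unfolding GL_iff_minor using g by simp
  moreover have "totally_positive g"
    unfolding totally_positive_def using g TP_D[OF tp] det_submatrix[of _ g] by auto
  ultimately show ?thesis unfolding GL_pos_def by simp
qed

lemma Fl_pos_subset_Fl_Plucker_pos:
  assumes K: "K \<subseteq> {..n}"
  shows "Fl_pos K n \<subseteq> Fl_Plucker_pos K n"
proof
  fix V assume "V \<in> Fl_pos K n"
  then obtain g where V: "V \<in> flags K n" and g: "g \<in> GL_pos n" and rep: "represents K n g V"
    unfolding Fl_pos_def by blast
  have gd: "dim_row g = n" "dim_col g = n" using g unfolding GL_pos_def GL_def by auto
  have "det (submatrix g I {..<k}) > 0" if "k \<in> K" "I \<subseteq> {..<n}" "card I = k" for k I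
  proof -
    have "k \<le> n" using that K by auto
    then have "{..<k} \<subseteq> {..<n}" by auto
    then show ?thesis using det_submatrix[of I g "{..<k}"] gd that TP_D[OF GL_pos_imp_TP[OF g], of I "{..<k}"] by simp
  qed
  then show "V \<in> Fl_Plucker_pos K n" unfolding Fl_Plucker_pos_def using V rep by blast
qed

lemma Fl_Plucker_pos_subset_Fl_pos:
  assumes K: "K = {a..b}" and a: "1 \<le> a" and b: "b \<le> n"
  shows "Fl_Plucker_pos K n \<subseteq> Fl_pos K n"
proof
  fix V assume "V \<in> Fl_Plucker_pos K n"
  then obtain A where V: "V \<in> flags K n" and rep: "represents K n A V"
    and pos: "\<And>k I. k \<in> K \<Longrightarrow> I \<subseteq> {..<n} \<Longrightarrow> card I = k \<Longrightarrow> det (submatrix A I {..<k}) > 0"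
    unfolding Fl_Plucker_pos_def by blast
  have A: "dim_row A = n" "k \<le> dim_col A" "V k = col_span n A k" if "k \<in> K" for k
    using rep that unfolding represents_def by auto
  have mpos: "max_minors_pos n k (ent A)" if k: "k \<in> K" for k
  proof -
    have "{..<k} \<subseteq> {..<dim_col A}" using A[OF k] by auto
    then show ?thesis unfolding max_minors_pos_def using det_submatrix[of _ A "{..<k}"] A[OF k] pos[OF k] by simp
  qed
  \<comment> \<open>An empty \<open>K\<close> gives no information on \<open>A\<close>, whatever
    \<open>b\<close> is; all columns are then chosen freely.\<close>
  define m where "m = (if K = {} then 0 else b)"
  have mn: "m \<le> n" using b unfolding m_def by simp
  have "\<exists>h. TP n m h \<and> (\<forall>j<m. \<exists>x. \<forall>i<n. h i j = (\<Sum>c<max a (Suc j). x c * A $$ (i, c)))"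
  proof (cases "K = {}")
    case True
    then show ?thesis using TP_0 unfolding m_def by auto
  next
    case False
    then have "a \<le> b" using K by simp
    then show ?thesis using minors_pos_imp_TP[of a b n "ent A"] b mpos K False unfolding m_def by auto
  qed
  then obtain h where h: "TP n m h" and dep: "\<And>j. j < m \<Longrightarrow> \<exists>x. \<forall>i<n. h i j = (\<Sum>c<max a (Suc j). x c * A $$ (i, c))"
    by auto
  obtain h' where h': "TP n n h'" "\<forall>i. \<forall>j<m. h' i j = h i j"
    using TP_append_cols[OF h, of "n - m"] mn by auto
  define g where "g = mat n n (\<lambda>(i, j). h' i j)"
  have gc: "g \<in> carrier_mat n n" unfolding g_def by simp
  have "minor (ent g) I J = minor h' I J" if IJ: "I \<subseteq> {..<n}" "J \<subseteq> {..<n}" for I J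
  proof (rule minor_cong)
    show "finite I" "finite J" using IJ by (meson finite_subset finite_lessThan)+
  qed (use IJ in \<open>simp add: g_def subset_iff\<close>)
  then have tp: "TP n n (ent g)" using h'(1) unfolding TP_def by simp
  have "col_span n g k = V k" if k: "k \<in> K" for k
  proof -
    have kb: "a \<le> k" "k \<le> m" using k K unfolding m_def by auto
    have "\<exists>x. \<forall>i<n. g $$ (i, j) = (\<Sum>c<k. A $$ (i, c) * x c)" if j: "j < k" for j
    proof -
      obtain x where x: "\<forall>i<n. h i j = (\<Sum>c<max a (Suc j). x c * A $$ (i, c))" using dep[of j] j kb by auto
      \<comment> \<open>As a <= k and j < k, the bound \<open>max a (Suc j)\<close> is at most k;
        the remaining coefficients are padded with zeros.\<close>
      have "g $$ (i, j) = (\<Sum>c<k. A $$ (i, c) * (if c < max a (Suc j) then x c else 0))" if i: "i < n" for i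
      proof -
        have "g $$ (i, j) = (\<Sum>c<max a (Suc j). x c * A $$ (i, c))"
          using i j kb mn h'(2) x unfolding g_def by simp
        also have "\<dots> = (\<Sum>c<k. A $$ (i, c) * (if c < max a (Suc j) then x c else 0))"
          using j kb by (intro sum.mono_neutral_cong_left) auto
        finally show ?thesis .
      qed
      then show ?thesis by (intro exI[of _ "\<lambda>c. if c < max a (Suc j) then x c else 0"]) auto
    qed
    then obtain X where X: "\<And>i j. i < n \<Longrightarrow> j < k \<Longrightarrow> g $$ (i, j) = (\<Sum>c<k. A $$ (i, c) * X j c)" by metis
    define M where "M = mat k k (\<lambda>(c, j). X j c)"
    have M: "M \<in> carrier_mat k k" unfolding M_def by simp
    have gM: "g $$ (i, j) = (\<Sum>c<k. A $$ (i, c) * M $$ (c, j))" if "i < n" "j < k" for i j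
      using X[OF that] that unfolding M_def by simp
    have "minor (ent g) {..<k} {..<k} = minor (ent A) {..<k} {..<k} * det M"
      using kb mn by (intro minor_mult[OF _ _ M] gM) auto
    moreover have "minor (ent g) {..<k} {..<k} > 0" using kb mn by (intro TP_D[OF tp]) auto
    \<comment> \<open>Total positivity of \<open>g\<close> rules out a singular change of basis, so
      the spans agree.\<close>
    ultimately have "det M \<noteq> 0" by auto
    have "k \<le> dim_col g" using gc kb mn by simp
    then have "col_span n g k = col_span n A k"
      using gc by (intro col_span_mult_eq[OF _ _ A(1,2)[OF k] M \<open>det M \<noteq> 0\<close> gM]) auto
    then show ?thesis using A[OF k] by simp
  qed
  then have "represents K n g V" unfolding represents_def using gc K b by auto
  then show "V \<in> Fl_pos K n" unfolding Fl_pos_def using V TP_imp_GL_pos[OF gc tp] by blast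
qed

section \<open>Closedness of the Plucker-nonnegative part\<close>

lemma topspace_mat_topology [simp]: "topspace (mat_topology m n) = carrier_mat m n"
  unfolding mat_topology_def topspace_pullback_topology by auto

lemma topspace_GL_topology [simp]: "topspace (GL_topology n) = GL n"
  unfolding GL_topology_def by (auto simp: GL_def)

lemma continuous_map_entry:
  assumes "i < m" "j < n"
  shows "continuous_map (mat_topology m n) euclideanreal (\<lambda>A. A $$ (i, j))"
proof -
  have "continuous_map (product_topology (\<lambda>_. euclideanreal) ({..<m} \<times> {..<n})) euclideanreal (\<lambda>x. x (i, j))"
    using assms continuous_map_product_projection[of "(i, j)" "{..<m} \<times> {..<n}" "\<lambda>_. euclideanreal"] by simp
  then have *: "continuous_map (mat_topology m n) euclideanreal ((\<lambda>x. x (i, j)) \<circ> (\<lambda>A. restrict (($$) A) ({..<m} \<times> {..<n})))"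
    unfolding mat_topology_def by (rule continuous_map_pullback)
  have eq: "(\<lambda>x. x (i, j)) \<circ> (\<lambda>A. restrict (($$) A) ({..<m} \<times> {..<n})) = (\<lambda>A. A $$ (i, j))"
    using assms by (auto simp: fun_eq_iff)
  show ?thesis using * unfolding eq .
qed

lemma continuous_map_minor:
  assumes "I \<subseteq> {..<n}" "J \<subseteq> {..<n}" "card I = card J"
  shows "continuous_map (GL_topology n) euclideanreal (\<lambda>A. minor (ent A) I J)"
  using assms
proof (induction "card J" arbitrary: I J)
  case 0
  then have "finite I" "finite J" by (meson finite_subset finite_lessThan)+
  then have "I = {}" "J = {}" using 0 by auto
  then show ?case by simp
next
  case (Suc k)
  have fin: "finite I" "finite J" using Suc.prems by (meson finite_subset finite_lessThan)+
  obtain j where j: "j \<in> J" using Suc.hyps(2) by fastforce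
  have entry: "continuous_map (GL_topology n) euclideanreal (\<lambda>A. A $$ (i, j))" if "i \<in> I" for i
    unfolding GL_topology_def using that j Suc.prems
    by (intro continuous_map_from_subtopology continuous_map_entry) auto
  have rec: "continuous_map (GL_topology n) euclideanreal (\<lambda>A. minor (ent A) (I - {i}) (J - {j}))" if "i \<in> I" for i
    using that j Suc.prems Suc.hyps(2) fin by (intro Suc.hyps(1)) auto
  show ?case unfolding minor_expand_col[OF fin Suc.prems(3) j]
    using fin entry rec by (intro continuous_map_sum continuous_map_real_mult) auto
qed

lemma topspace_flag_topology:
  assumes "K \<subseteq> {..n}"
  shows "topspace (flag_topology K n) = flags K n"
proof -
  have "{g \<in> GL n. flag_of K n g \<in> flags K n} = GL n" using flag_of_in_flags[OF _ assms] by blast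
  then have "openin (flag_topology K n) (flags K n)"
    unfolding openin_flag_topology using openin_topspace[of "GL_topology n"] by simp
  then have "flags K n \<subseteq> topspace (flag_topology K n)" by (rule openin_subset)
  moreover have "topspace (flag_topology K n) \<subseteq> flags K n"
    using openin_topspace[of "flag_topology K n"] unfolding openin_flag_topology by blast
  ultimately show ?thesis by blast
qed

text \<open>In the quotient topology openness is tested on preimages in \<open>GL n\<close>. Since
  \<open>Q\<close> is constant on the fibres, the complement of the set pulls back to the complement
  of \<open>Q\<close>.\<close>

lemma closedin_flag_topologyI:
  assumes K: "K \<subseteq> {..n}"
    and inv: "\<And>g h. g \<in> GL n \<Longrightarrow> h \<in> GL n \<Longrightarrow> flag_of K n g = flag_of K n h \<Longrightarrow> Q g \<Longrightarrow> Q h"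
    and closed: "closedin (GL_topology n) {g \<in> GL n. Q g}"
  shows "closedin (flag_topology K n) {V \<in> flags K n. \<exists>g\<in>GL n. flag_of K n g = V \<and> Q g}" (is "closedin _ ?C")
proof -
  have "{g \<in> GL n. flag_of K n g \<in> flags K n - ?C} = GL n - {g \<in> GL n. Q g}"
    using flag_of_in_flags[OF _ K] inv by fast
  then have "openin (flag_topology K n) (flags K n - ?C)"
    unfolding openin_flag_topology using closed unfolding closedin_def by simp
  then show ?thesis unfolding closedin_def topspace_flag_topology[OF K] by auto
qed

text \<open>Nonnegativity of the minors of \<open>g\<close> depends on the representative, whereas
  the product of two coordinates of equal size changes by a square. This form is therefore a
  property of the flag, and it is closed.\<close>

definition sign_coherent :: "nat set \<Rightarrow> nat \<Rightarrow> real mat \<Rightarrow> bool" where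
  "sign_coherent K n g \<longleftrightarrow> (\<forall>k\<in>K. \<forall>I J. I \<subseteq> {..<n} \<longrightarrow> J \<subseteq> {..<n} \<longrightarrow> card I = k \<longrightarrow> card J = k \<longrightarrow>
     minor (ent g) I {..<k} * minor (ent g) J {..<k} \<ge> 0)"

lemma flag_of_eq_imp_minor_mult:
  assumes g: "g \<in> GL n" and h: "h \<in> GL n" and eq: "flag_of K n g = flag_of K n h" and k: "k \<in> K" "k \<le> n"
  obtains d where "\<And>I. I \<subseteq> {..<n} \<Longrightarrow> card I = k \<Longrightarrow> minor (ent h) I {..<k} = minor (ent g) I {..<k} * d"
proof -
  have "col_span n h k = col_span n g k" using fun_cong[OF eq, of k] k(1) unfolding flag_of_def by simp
  moreover have "dim_row g = n" "dim_col g = n" "dim_row h = n" "dim_col h = n" using g h unfolding GL_def by auto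
  ultimately show thesis using col_span_eq_imp_minor_mult[of h n k g] k(2) that by auto
qed

lemma sign_coherent_flag_of:
  assumes K: "K \<subseteq> {..n}" and "g \<in> GL n" "h \<in> GL n" "flag_of K n g = flag_of K n h" "sign_coherent K n g"
  shows "sign_coherent K n h"
  unfolding sign_coherent_def
proof (intro ballI allI impI)
  fix k I J assume k: "k \<in> K" and IJ: "I \<subseteq> {..<n}" "J \<subseteq> {..<n}" "card I = k" "card J = k"
  have kn: "k \<le> n" using k K by auto
  obtain d where d: "\<And>I. I \<subseteq> {..<n} \<Longrightarrow> card I = k \<Longrightarrow> minor (ent h) I {..<k} = minor (ent g) I {..<k} * d"
    by (rule flag_of_eq_imp_minor_mult[OF assms(2-4) k kn]) auto
  have "minor (ent h) I {..<k} * minor (ent h) J {..<k} = minor (ent g) I {..<k} * minor (ent g) J {..<k} * d\<^sup>2"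
    using d IJ by (simp add: power2_eq_square)
  also have "minor (ent g) I {..<k} * minor (ent g) J {..<k} \<ge> 0"
    using assms(5) k IJ unfolding sign_coherent_def by blast
  then have "minor (ent g) I {..<k} * minor (ent g) J {..<k} * d\<^sup>2 \<ge> 0" by simp
  finally show "0 \<le> minor (ent h) I {..<k} * minor (ent h) J {..<k}" .
qed

lemma closedin_sign_coherent:
  assumes K: "K \<subseteq> {..n}"
  shows "closedin (GL_topology n) {g \<in> GL n. sign_coherent K n g}"
proof -
  define P where "P = {(k, I, J). k \<in> K \<and> I \<subseteq> {..<n} \<and> J \<subseteq> {..<n} \<and> card I = k \<and> card J = k}"
  define C where "C = (\<lambda>(k, I, J). {g \<in> GL n. minor (ent g) I {..<k} * minor (ent g) J {..<k} \<in> {0..}})"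
  have "closedin (GL_topology n) (C p)" if p: "p \<in> P" for p
  proof -
    obtain k I J where pp: "p = (k, I, J)" by (cases p)
    have kn: "{..<k} \<subseteq> {..<n}" using p K unfolding pp P_def by auto
    have "continuous_map (GL_topology n) euclideanreal (\<lambda>g. minor (ent g) I {..<k} * minor (ent g) J {..<k})"
      using p kn unfolding pp P_def by (intro continuous_map_real_mult continuous_map_minor) auto
    from closedin_continuous_map_preimage[OF this, of "{0..}"]
    show ?thesis unfolding C_def pp by simp
  qed
  \<comment> \<open>For empty \<open>K\<close> the family is empty; inserting \<open>GL n\<close>
    keeps the intersection inside the space.\<close>
  then have "closedin (GL_topology n) (\<Inter>(insert (GL n) (C ` P)))"
    using closedin_topspace[of "GL_topology n"] by (intro closedin_Inter) auto
  moreover have "\<Inter>(insert (GL n) (C ` P)) = {g \<in> GL n. sign_coherent K n g}"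
    unfolding sign_coherent_def C_def P_def by auto
  ultimately show ?thesis by simp
qed

text \<open>Flipping the sign of the column \<open>c\<close> by \<open>\<epsilon> (c + 1) \<cdot> \<epsilon> c\<close> multiplies the minors on the first
  \<open>k\<close> columns by the telescoping product \<open>\<epsilon> k\<close>.\<close>

lemma sign_coherent_imp_Plucker_nonneg:
  assumes K: "K \<subseteq> {1..n}" and g: "g \<in> GL n" and sc: "sign_coherent K n g"
  shows "flag_of K n g \<in> Fl_Plucker_nonneg K n"
proof -
  have gd: "g \<in> carrier_mat n n" using g unfolding GL_def by auto
  \<comment> \<open>\<open>e k\<close> is the common sign of the coordinates of size k, set to 1 for
    sizes outside \<open>K\<close>; in particular \<open>e 0 = 1\<close>, where the telescoping
    product starts.\<close>
  define e :: "nat \<Rightarrow> real" where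
    "e k = (if k \<in> K \<and> (\<exists>I. I \<subseteq> {..<n} \<and> card I = k \<and> minor (ent g) I {..<k} < 0) then -1 else 1)" for k
  have e2: "e k * e k = 1" for k unfolding e_def by simp
  have e0: "e 0 = 1" using K unfolding e_def by auto
  have enn: "minor (ent g) I {..<k} * e k \<ge> 0" if k: "k \<in> K" and I: "I \<subseteq> {..<n}" "card I = k" for k I
  proof (cases "\<exists>J. J \<subseteq> {..<n} \<and> card J = k \<and> minor (ent g) J {..<k} < 0")
    case True
    then obtain J where J: "J \<subseteq> {..<n}" "card J = k" "minor (ent g) J {..<k} < 0" by blast
    then have "minor (ent g) I {..<k} * minor (ent g) J {..<k} \<ge> 0" using sc k I unfolding sign_coherent_def by auto
    then have "minor (ent g) I {..<k} \<le> 0" using J(3) by (simp add: zero_le_mult_iff)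
    moreover have "e k = -1" unfolding e_def using k True by simp
    ultimately show ?thesis by simp
  next
    case False
    then have "minor (ent g) I {..<k} \<ge> 0" using I by force
    moreover have "e k = 1" unfolding e_def using False by simp
    ultimately show ?thesis by simp
  qed
  define A where "A = mat n n (\<lambda>(i, j). g $$ (i, j) * (e (Suc j) * e j))"
  have Ad: "A \<in> carrier_mat n n" unfolding A_def by simp
  define M where "M k = mat k k (\<lambda>(c, j). if c = j then e (Suc j) * e j else 0)" for k
  have M: "M k \<in> carrier_mat k k" for k unfolding M_def by simp
  have prod: "(\<Prod>j<k. e (Suc j) * e j) = e k" for k
    by (induction k) (simp_all add: e0 e2 mult_ac)
  have "det (M k) = prod_list (diag_mat (M k))" for k
    by (rule det_upper_triangular[OF _ M]) (auto simp: M_def upper_triangular_def)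
  also have "prod_list (diag_mat (M k)) = (\<Prod>j<k. e (Suc j) * e j)" for k
    unfolding prod_list_diag_prod by (intro prod.cong) (auto simp: M_def)
  finally have detM: "det (M k) = e k" for k unfolding prod .
  have AM: "A $$ (i, j) = (\<Sum>c<k. g $$ (i, c) * M k $$ (c, j))" if "i < n" "j < k" "k \<le> n" for i j k
  proof -
    have "(\<Sum>c<k. g $$ (i, c) * M k $$ (c, j)) = (\<Sum>c<k. if c = j then g $$ (i, j) * (e (Suc j) * e j) else 0)"
      using that by (intro sum.cong) (auto simp: M_def)
    then show ?thesis using that by (simp add: A_def)
  qed
  have kn: "k \<le> n" if "k \<in> K" for k using that K by auto
  have minorA: "minor (ent A) I {..<k} = minor (ent g) I {..<k} * e k" if k: "k \<in> K" and I: "I \<subseteq> {..<n}" "card I = k" for k I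
  proof -
    have "minor (ent A) I {..<k} = minor (ent g) I {..<k} * det (M k)"
    proof (rule minor_mult[OF _ I(2) M])
      show "finite I" using I finite_subset by auto
    qed (use I AM kn[OF k] in auto)
    then show ?thesis unfolding detM .
  qed
  have "det (submatrix A I {..<k}) \<ge> 0" if k: "k \<in> K" and I: "I \<subseteq> {..<n}" "card I = k" for k I
  proof -
    have "{..<k} \<subseteq> {..<n}" using kn[OF k] by auto
    then have "det (submatrix A I {..<k}) = minor (ent A) I {..<k}"
      using det_submatrix[of I A "{..<k}"] Ad I by simp
    then show ?thesis using minorA[OF k I] enn[OF k I] by simp
  qed
  moreover have "represents K n A (flag_of K n g)"
  proof -
    have "col_span n A k = col_span n g k" if k: "k \<in> K" for k
    proof (rule col_span_mult_eq[OF _ _ _ _ M[of k]])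
      have "e k \<noteq> 0" unfolding e_def by simp
      then show "det (M k) \<noteq> 0" unfolding detM .
    qed (use Ad gd kn[OF k] AM in auto)
    then show ?thesis unfolding represents_def flag_of_def using Ad kn by auto
  qed
  moreover have "K \<subseteq> {..n}" using K by auto
  ultimately show ?thesis unfolding Fl_Plucker_nonneg_def using flag_of_in_flags[OF g] by blast
qed

lemma Fl_Plucker_nonnegE:
  assumes K: "K \<subseteq> {..n}" and V: "V \<in> Fl_Plucker_nonneg K n"
  obtains g where "g \<in> GL n" "flag_of K n g = V"
    "\<And>k I. k \<in> K \<Longrightarrow> I \<subseteq> {..<n} \<Longrightarrow> card I = k \<Longrightarrow> minor (ent g) I {..<k} \<ge> 0"
proof -
  obtain A where VF: "V \<in> flags K n" and rep: "represents K n A V"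
    and nn: "\<And>k I. k \<in> K \<Longrightarrow> I \<subseteq> {..<n} \<Longrightarrow> card I = k \<Longrightarrow> det (submatrix A I {..<k}) \<ge> 0"
    using V unfolding Fl_Plucker_nonneg_def by blast
  obtain g where g: "g \<in> GL n" "flag_of K n g = V" "\<And>k i j. k \<in> K \<Longrightarrow> i < n \<Longrightarrow> j < k \<Longrightarrow> g $$ (i, j) = A $$ (i, j)"
    by (rule flags_represented_by_GL[OF VF rep K]) auto
  have "minor (ent g) I {..<k} \<ge> 0" if k: "k \<in> K" and I: "I \<subseteq> {..<n}" "card I = k" for k I
  proof -
    have A: "dim_row A = n" "k \<le> dim_col A" using rep k unfolding represents_def by auto
    have "minor (ent g) I {..<k} = minor (ent A) I {..<k}"
    proof (rule minor_cong)
      show "finite I" using I finite_subset by auto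
    qed (use I g(3)[OF k] in auto)
    also have "\<dots> = det (submatrix A I {..<k})" using A I by (intro det_submatrix[symmetric]) auto
    finally show ?thesis using nn[OF k I] by simp
  qed
  then show thesis using that g by blast
qed

lemma closedin_Fl_Plucker_nonneg:
  assumes K: "K \<subseteq> {1..n}"
  shows "closedin (flag_topology K n) (Fl_Plucker_nonneg K n)"
proof -
  have K': "K \<subseteq> {..n}" using K by auto
  have "Fl_Plucker_nonneg K n = {V \<in> flags K n. \<exists>g\<in>GL n. flag_of K n g = V \<and> sign_coherent K n g}"
  proof (rule equalityI; rule subsetI)
    fix V assume V: "V \<in> Fl_Plucker_nonneg K n"
    obtain g where g: "g \<in> GL n" "flag_of K n g = V"
      "\<And>k I. k \<in> K \<Longrightarrow> I \<subseteq> {..<n} \<Longrightarrow> card I = k \<Longrightarrow> minor (ent g) I {..<k} \<ge> 0"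
      by (rule Fl_Plucker_nonnegE[OF K' V]) auto
    have "sign_coherent K n g" unfolding sign_coherent_def using g(3) by simp
    then show "V \<in> {V \<in> flags K n. \<exists>g\<in>GL n. flag_of K n g = V \<and> sign_coherent K n g}"
      using V g(1,2) unfolding Fl_Plucker_nonneg_def by blast
  next
    fix V assume "V \<in> {V \<in> flags K n. \<exists>g\<in>GL n. flag_of K n g = V \<and> sign_coherent K n g}"
    then show "V \<in> Fl_Plucker_nonneg K n" using sign_coherent_imp_Plucker_nonneg[OF K] by blast
  qed
  then show ?thesis
    using closedin_flag_topologyI[OF K' sign_coherent_flag_of[OF K'] closedin_sign_coherent[OF K']] by simp
qed

section \<open>Density of the Plucker-positive part\<close>

text \<open>Expansion along row \<open>p\<close> on one side and row \<open>q\<close> on the other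
  meets the same cofactors, and ranks enter only by parity. This serves both for neighbouring rows
  and for rows k - 1 and k + 2 of the counterexample.\<close>

lemma minor_move_row:
  assumes I: "finite I" "card I = card J" "p \<in> I" and I': "finite I'" "q \<in> I'" "I - {p} = I' - {q}" and J: "finite J"
    and par: "even (pos I p) = even (pos I' q)"
    and eq: "\<And>j. j \<in> J \<Longrightarrow> f p j = g q j" "\<And>i j. i \<in> I - {p} \<Longrightarrow> j \<in> J \<Longrightarrow> f i j = g i j"
  shows "minor f I J = minor g I' J"
proof -
  have "card I' = Suc (card (I' - {q}))" "card I = Suc (card (I - {p}))"
    by (rule card.remove; fact)+
  then have "card I' = card J" unfolding I'(3)[symmetric] I(2) by simp
  have "minor f I J = (\<Sum>j\<in>J. (-1) ^ (pos I p + pos J j) * f p j * minor f (I - {p}) (J - {j}))"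
    by (rule minor_expand_row[OF I(1) J I(2,3)])
  also have "\<dots> = (\<Sum>j\<in>J. (-1) ^ (pos I' q + pos J j) * g q j * minor g (I' - {q}) (J - {j}))"
  proof (rule sum.cong[OF refl])
    fix j assume j: "j \<in> J"
    have "minor f (I - {p}) (J - {j}) = minor g (I - {p}) (J - {j})"
      using I(1) J eq(2) by (intro minor_cong) auto
    moreover have "(-1 :: 'a) ^ (pos I p + pos J j) = (-1) ^ (pos I' q + pos J j)"
      using par by (simp add: minus_one_power_iff)
    ultimately show "(-1) ^ (pos I p + pos J j) * f p j * minor f (I - {p}) (J - {j}) =
        (-1) ^ (pos I' q + pos J j) * g q j * minor g (I' - {q}) (J - {j})"
      using eq(1)[OF j] I'(3) by simp
  qed
  also have "\<dots> = minor g I' J"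
    by (rule minor_expand_row[OF I'(1) J \<open>card I' = card J\<close> I'(2), symmetric])
  finally show ?thesis .
qed

definition add_row :: "(nat \<Rightarrow> nat \<Rightarrow> 'a::comm_ring_1) \<Rightarrow> nat \<Rightarrow> nat \<Rightarrow> 'a \<Rightarrow> nat \<Rightarrow> nat \<Rightarrow> 'a" where
  "add_row f p q t = (\<lambda>i j. if i = p then f p j + t * f q j else f i j)"

text \<open>Replacing \<open>p\<close> by \<open>q\<close> in \<open>I\<close> costs a sign for each
  selected index strictly between them. Adjacency leaves none, so the extra minor has coefficient
  exactly \<open>t\<close>; if all minors are nonnegative, none decreases for t > 0.\<close>

lemma minor_add_adjacent_row:
  assumes fin: "finite I" "finite J" and card: "card I = card J" and adj: "q = Suc p \<or> p = Suc q"
  shows "minor (add_row f p q t) I J =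
    minor f I J + (if p \<in> I \<and> q \<notin> I then t * minor f (insert q (I - {p})) J else 0)"
proof (cases "p \<in> I")
  case False
  then have "minor (add_row f p q t) I J = minor f I J"
    using fin by (intro minor_cong) (auto simp: add_row_def)
  then show ?thesis using False by simp
next
  case True
  define g where "g = (\<lambda>i j. if i = p then f q j else f i j)"
  have ex: "minor h I J = (\<Sum>j\<in>J. (-1) ^ (pos I p + pos J j) * h p j * minor f (I - {p}) (J - {j}))"
    if "\<And>i j. i \<noteq> p \<Longrightarrow> h i j = f i j" for h
    unfolding minor_expand_row[OF fin card True, of h]
    by (intro sum.cong refl arg_cong2[of _ _ _ _ times] minor_cong) (use fin that in auto)
  have "minor (add_row f p q t) I J = minor f I J + t * minor g I J"
    using ex[of "add_row f p q t"] ex[of f] ex[of g]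
    by (simp add: add_row_def g_def sum_distrib_left sum.distrib algebra_simps)
  moreover have "minor g I J = (if q \<in> I then 0 else minor f (insert q (I - {p})) J)"
  proof (cases "q \<in> I")
    case q: True
    have "minor (\<lambda>j i. g i j) J I = 0"
      using fin card True q adj by (intro minor_identical_cols[of _ _ p q]) (auto simp: g_def)
    then show ?thesis using q minor_transpose[OF card, of g] by simp
  next
    case q: False
    have "{a \<in> I. a < p} = {a \<in> insert q (I - {p}). a < q}"
      using adj q by (auto simp: less_Suc_eq)
    then have "pos I p = pos (insert q (I - {p})) q" unfolding pos_def by simp
    then have "minor g I J = minor f (insert q (I - {p})) J"
      using fin card True q adj by (intro minor_move_row[of I J p _ q]) (auto simp: g_def)
    then show ?thesis using q by simp
  qed
  ultimately show ?thesis using True by simp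
qed

lemma exists_gap_below:
  assumes "finite J" "card J = k" "J \<noteq> {..<k}"
  shows "\<exists>p. p \<notin> J \<and> Suc p \<in> J"
proof (rule ccontr)
  assume "\<not> ?thesis"
  then have down: "p \<in> J" if "Suc p \<in> J" for p using that by blast
  have closed: "x \<in> J \<Longrightarrow> y \<le> x \<Longrightarrow> y \<in> J" for x y
    by (induction x) (auto simp: le_Suc_eq dest: down)
  have "J \<subseteq> {..<k}"
  proof
    fix x assume "x \<in> J"
    then have "{..x} \<subseteq> J" using closed by auto
    then have "card {..x} \<le> card J" using assms(1) by (intro card_mono) auto
    then show "x \<in> {..<k}" using assms(2) by simp
  qed
  then have "J = {..<k}" using assms by (intro card_subset_eq) auto
  then show False using assms by simp
qed

text \<open>The graph on the \<open>k\<close>-subsets of \<open>{..<n}\<close>, with edges moving one element by one step, is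
  connected, since every vertex descends to \<open>{..<k}\<close>.\<close>

lemma adjacent_moves_connected:
  assumes S: "I0 \<in> S" "I0 \<subseteq> {..<n}" "card I0 = k"
    and step: "\<And>I p q. I \<subseteq> {..<n} \<Longrightarrow> card I = k \<Longrightarrow> p \<in> I \<Longrightarrow> q \<notin> I \<Longrightarrow> q < n \<Longrightarrow> q = Suc p \<or> p = Suc q \<Longrightarrow>
      insert q (I - {p}) \<in> S \<Longrightarrow> I \<in> S"
    and I: "I \<subseteq> {..<n}" "card I = k"
  shows "I \<in> S"
proof -
  have desc: "\<exists>p. p \<notin> J \<and> Suc p \<in> J \<and> Suc p < n \<and> insert p (J - {Suc p}) \<subseteq> {..<n} \<and>
      card (insert p (J - {Suc p})) = k \<and> \<Sum>(insert p (J - {Suc p})) < \<Sum>J"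
    if J: "J \<subseteq> {..<n}" "card J = k" "J \<noteq> {..<k}" for J
  proof -
    have fin: "finite J" using J finite_subset by auto
    obtain p where p: "p \<notin> J" "Suc p \<in> J" using exists_gap_below[OF fin J(2,3)] by blast
    have "\<Sum>J = Suc p + \<Sum>(J - {Suc p})" using sum.remove[OF fin p(2), of "\<lambda>x. x"] by simp
    then have "\<Sum>(insert p (J - {Suc p})) < \<Sum>J" using fin p by simp
    moreover have "card (insert p (J - {Suc p})) = k" using fin p J(2) card_gt_0_iff[of J] by auto
    moreover have "Suc p < n" using p J by auto
    moreover have "insert p (J - {Suc p}) \<subseteq> {..<n}" using p J \<open>Suc p < n\<close> by auto
    ultimately show ?thesis using p by blast
  qed
  have low: "J \<in> S \<Longrightarrow> J \<subseteq> {..<n} \<Longrightarrow> card J = k \<Longrightarrow> {..<k} \<in> S" for J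
  proof (induction "\<Sum>J" arbitrary: J rule: less_induct)
    case less
    show ?case
    proof (cases "J = {..<k}")
      case True
      then show ?thesis using less.prems by simp
    next
      case False
      obtain p where p: "p \<notin> J" "Suc p \<in> J" "Suc p < n" "insert p (J - {Suc p}) \<subseteq> {..<n}"
        "card (insert p (J - {Suc p})) = k" "\<Sum>(insert p (J - {Suc p})) < \<Sum>J"
        using desc[OF less.prems(2,3) False] by blast
      have "insert (Suc p) (insert p (J - {Suc p}) - {p}) = J" using p by auto
      then have "insert p (J - {Suc p}) \<in> S"
        using step[OF p(4,5), of p "Suc p"] p less.prems(1) by auto
      then show ?thesis using less.hyps[OF p(6)] p by blast
    qed
  qed
  \<comment> \<open>Descending from \<open>I0\<close> puts the lowest set into \<open>S\<close>;
    descents from any other set, read backwards, then reach that set.\<close>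
  have base: "{..<k} \<in> S" by (rule low[OF S])
  show ?thesis using I
  proof (induction "\<Sum>I" arbitrary: I rule: less_induct)
    case less
    show ?case
    proof (cases "I = {..<k}")
      case True
      then show ?thesis using base by simp
    next
      case False
      obtain p where p: "p \<notin> I" "Suc p \<in> I" "Suc p < n" "insert p (I - {Suc p}) \<subseteq> {..<n}"
        "card (insert p (I - {Suc p})) = k" "\<Sum>(insert p (I - {Suc p})) < \<Sum>I"
        using desc[OF less.prems False] by blast
      have "insert p (I - {Suc p}) \<in> S" by (rule less.hyps[OF p(6,4,5)])
      then show ?thesis using step[OF less.prems, of "Suc p" p] p by auto
    qed
  qed
qed

lemma continuous_map_add_row:
  assumes g: "g \<in> carrier_mat n n" and GL: "\<And>t. mat n n (\<lambda>(i, j). add_row (ent g) p q t i j) \<in> GL n"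
  shows "continuous_map euclideanreal (GL_topology n) (\<lambda>t. mat n n (\<lambda>(i, j). add_row (ent g) p q t i j))"
proof -
  let ?m = "\<lambda>t. mat n n (\<lambda>(i, j). add_row (ent g) p q t i j)"
  have "continuous_map euclideanreal (product_topology (\<lambda>_. euclideanreal) ({..<n} \<times> {..<n}))
     (\<lambda>t. restrict (($$) (?m t)) ({..<n} \<times> {..<n}))"
    unfolding continuous_map_componentwise
  proof (intro conjI ballI)
    fix x assume "x \<in> {..<n} \<times> {..<n}"
    then obtain i j where ij: "x = (i, j)" "i < n" "j < n" by auto
    then have "(\<lambda>t. restrict (($$) (?m t)) ({..<n} \<times> {..<n}) x) = (\<lambda>t. add_row (ent g) p q t i j)"
      by (auto simp: fun_eq_iff)
    moreover have "continuous_on UNIV (\<lambda>t. add_row (ent g) p q t i j)"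
      unfolding add_row_def by (cases "i = p") (auto intro!: continuous_intros)
    ultimately show "continuous_map euclideanreal euclideanreal (\<lambda>t. restrict (($$) (?m t)) ({..<n} \<times> {..<n}) x)"
      by simp
  qed auto
  then have "continuous_map euclideanreal (mat_topology n n) ?m"
    unfolding mat_topology_def by (intro continuous_map_pullback') (auto simp: o_def)
  then show ?thesis unfolding GL_topology_def continuous_map_in_subtopology using GL by auto
qed

text \<open>Induction on the number of vanishing coordinates. Each size in \<open>K\<close> has a
  nonzero coordinate, so where positivity fails, connectedness finds a vanishing coordinate adjacent
  to a positive one. The row operation with small t > 0 makes it positive, lowers no coordinate of
  any size, and stays in \<open>U\<close> by continuity at 0.\<close>

lemma flag_neighbourhood_Plucker_pos:
  assumes K: "K \<subseteq> {..n}" and U: "openin (flag_topology K n) U"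
    and g: "g \<in> GL n" "flag_of K n g \<in> U"
    and nonneg: "\<And>k I. k \<in> K \<Longrightarrow> I \<subseteq> {..<n} \<Longrightarrow> card I = k \<Longrightarrow> minor (ent g) I {..<k} \<ge> 0"
  shows "\<exists>h\<in>GL n. flag_of K n h \<in> U \<and> (\<forall>k\<in>K. max_minors_pos n k (ent h))"
  using g nonneg
proof (induction "card {(k, I). k \<in> K \<and> I \<subseteq> {..<n} \<and> card I = k \<and> minor (ent g) I {..<k} = 0}"
    arbitrary: g rule: less_induct)
  case less
  define Z where "Z g = {(k, I). k \<in> K \<and> I \<subseteq> {..<n} \<and> card I = k \<and> minor (ent g) I {..<k} = 0}" for g :: "real mat"
  have finZ: "finite (Z g)" for g
    by (rule finite_subset[of _ "{..n} \<times> Pow {..<n}"]) (use K in \<open>auto simp: Z_def\<close>)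
  have gc: "g \<in> carrier_mat n n" using less.prems(1) unfolding GL_def by auto
  have K_rep: "represents K n g (flag_of K n g)"
    using represents_GL_iff[OF less.prems(1) K, of "flag_of K n g"] unfolding flag_of_def by simp
  show ?case
  proof (cases "\<forall>k\<in>K. max_minors_pos n k (ent g)")
    case True
    then show ?thesis using less.prems by blast
  next
    case False
    then obtain k I1 where k: "k \<in> K" and I1: "I1 \<subseteq> {..<n}" "card I1 = k" "\<not> minor (ent g) I1 {..<k} > 0"
      unfolding max_minors_pos_def by blast
    define S where "S = {I. minor (ent g) I {..<k} > 0}"
    obtain I0 where I0: "I0 \<subseteq> {..<n}" "card I0 = k" "minor (ent g) I0 {..<k} \<noteq> 0"
      by (rule flags_imp_minor[OF flag_of_in_flags[OF less.prems(1) K] K_rep k]) auto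
    then have "I0 \<in> S" using less.prems(3)[OF k] unfolding S_def by (simp add: order_less_le)
    have "\<exists>I p q. I \<subseteq> {..<n} \<and> card I = k \<and> p \<in> I \<and> q \<notin> I \<and> q < n \<and> (q = Suc p \<or> p = Suc q) \<and>
      insert q (I - {p}) \<in> S \<and> I \<notin> S"
    proof (rule ccontr)
      assume "\<not> ?thesis"
      then have "I1 \<in> S" using adjacent_moves_connected[OF \<open>I0 \<in> S\<close> I0(1,2) _ I1(1,2)] by blast
      then show False using I1(3) unfolding S_def by simp
    qed
    then obtain I p q where I: "I \<subseteq> {..<n}" "card I = k" "p \<in> I" "q \<notin> I" "q < n" and adj: "q = Suc p \<or> p = Suc q"
      and S: "insert q (I - {p}) \<in> S" "I \<notin> S" by auto
    define m where "m t = mat n n (\<lambda>(i, j). add_row (ent g) p q t i j)" for t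
    have mc: "m t \<in> carrier_mat n n" for t unfolding m_def by simp
    have minor_m: "minor (ent (m t)) I' {..<l} = minor (ent g) I' {..<l} +
        (if p \<in> I' \<and> q \<notin> I' then t * minor (ent g) (insert q (I' - {p})) {..<l} else 0)"
      if "I' \<subseteq> {..<n}" "card I' = l" "l \<le> n" for I' l t
    proof -
      have fin: "finite I'" using that finite_subset by auto
      have "minor (ent (m t)) I' {..<l} = minor (add_row (ent g) p q t) I' {..<l}"
      proof (rule minor_cong)
        fix i j assume "i \<in> I'" "j \<in> {..<l}"
        then have "i < n" "j < n" using that by auto
        then show "ent (m t) i j = add_row (ent g) p q t i j" unfolding m_def by simp
      qed (use fin in auto)
      then show ?thesis using minor_add_adjacent_row[OF fin finite_lessThan _ adj, of l "ent g" t] that by simp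
    qed
    \<comment> \<open>When all n rows are selected, \<open>q\<close> is among them and the
      correction term drops out: the determinant does not change.\<close>
    have mGL: "m t \<in> GL n" for t
      unfolding GL_iff_minor using mc minor_m[of "{..<n}" n t] I(5) less.prems(1) unfolding GL_iff_minor by simp
    have "continuous_map euclideanreal (GL_topology n) m"
      unfolding m_def by (rule continuous_map_add_row[OF gc]) (use mGL m_def in simp)
    moreover have "openin (GL_topology n) {g \<in> GL n. flag_of K n g \<in> U}" using U unfolding openin_flag_topology by simp
    ultimately have "openin euclideanreal {t \<in> topspace euclideanreal. m t \<in> {g \<in> GL n. flag_of K n g \<in> U}}"
      by (rule openin_continuous_map_preimage)
    then have "open {t. m t \<in> {g \<in> GL n. flag_of K n g \<in> U}}" by simp
    moreover have "m 0 = g" unfolding m_def add_row_def using gc by (intro eq_matI) auto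
    then have "0 \<in> {t. m t \<in> {g \<in> GL n. flag_of K n g \<in> U}}" using less.prems by simp
    ultimately have "eventually (\<lambda>t. t \<in> {t. m t \<in> {g \<in> GL n. flag_of K n g \<in> U}}) (nhds 0)"
      by (rule eventually_nhds_in_open)
    then have "eventually (\<lambda>t. m t \<in> {g \<in> GL n. flag_of K n g \<in> U}) (at_right 0)"
      by (simp add: eventually_at_filter eventually_mono)
    then obtain t where t: "t > 0" and "m t \<in> {g \<in> GL n. flag_of K n g \<in> U}"
      by (rule at_right_obtain)
    then have tU: "flag_of K n (m t) \<in> U" by blast
    have swap_nonneg: "minor (ent g) (insert q (I' - {p})) {..<l} \<ge> 0"
      if "l \<in> K" "I' \<subseteq> {..<n}" "card I' = l" "p \<in> I'" "q \<notin> I'" for I' l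
    proof (rule less.prems(3)[OF that(1)])
      have fin: "finite I'" using that finite_subset by auto
      show "insert q (I' - {p}) \<subseteq> {..<n}" using that I(5) by auto
      show "card (insert q (I' - {p})) = l" using fin that card_gt_0_iff[of I'] by auto
    qed
    have ge: "minor (ent (m t)) I' {..<l} \<ge> minor (ent g) I' {..<l}"
      if "l \<in> K" "I' \<subseteq> {..<n}" "card I' = l" for I' l
      using minor_m[of I' l t] that K swap_nonneg[of l I'] t by auto
    have nn: "minor (ent (m t)) I' {..<l} \<ge> 0" if "l \<in> K" "I' \<subseteq> {..<n}" "card I' = l" for I' l
      using ge[OF that(1-3)] less.prems(3)[OF that(1-3)] by simp
    have gI: "minor (ent g) I {..<k} = 0" using S(2) less.prems(3)[OF k I(1,2)] unfolding S_def by simp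
    have "k \<le> n" using k K by auto
    then have "minor (ent (m t)) I {..<k} = t * minor (ent g) (insert q (I - {p})) {..<k}"
      using minor_m[OF I(1,2), of t] I(3,4) gI by simp
    also have "\<dots> > 0" using S(1) t unfolding S_def by simp
    finally have "(k, I) \<notin> Z (m t)" unfolding Z_def by simp
    moreover have "(k, I) \<in> Z g" unfolding Z_def using k I gI by simp
    moreover have "Z (m t) \<subseteq> Z g"
    proof
      fix x assume "x \<in> Z (m t)"
      then obtain l I' where x: "x = (l, I')" "l \<in> K" "I' \<subseteq> {..<n}" "card I' = l" "minor (ent (m t)) I' {..<l} = 0"
        unfolding Z_def by auto
      then have "minor (ent g) I' {..<l} = 0" using ge[OF x(2-4)] less.prems(3)[OF x(2-4)] by simp
      then show "x \<in> Z g" unfolding Z_def using x by simp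
    qed
    ultimately have "Z (m t) \<subset> Z g" by blast
    then have "card (Z (m t)) < card (Z g)" using finZ by (intro psubset_card_mono)
    then show ?thesis using less.hyps[of "m t"] mGL tU nn unfolding Z_def by blast
  qed
qed

section \<open>Dimensions with a gap\<close>

lemma minor_row_combination:
  assumes C: "finite C" and J: "J \<subseteq> {..<m}" and card: "card C = Suc (card J)"
    and comb: "\<And>c. c \<in> C \<Longrightarrow> f m c = (\<Sum>i<m. y i * f i c)"
  shows "minor f (insert m J) C = (\<Sum>i\<in>{..<m} - J. y i * (-1) ^ card {r \<in> J. i < r} * minor f (insert i J) C)"
proof -
  define ft where "ft = (\<lambda>c r. f r c)"
  have finJ: "finite J" using J finite_subset by auto
  have mJ: "m \<notin> J" using J by auto
  have cardm: "card C = card (insert m J)" using card finJ mJ by simp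
  have "minor f (insert m J) C = minor ft C (insert m J)"
    unfolding ft_def using cardm by (intro minor_transpose[symmetric]) simp
  also have "\<dots> = minor (col_upd ft m (\<lambda>c. \<Sum>i<m. y i * ft c i)) C (insert m J)"
    using C finJ comb by (intro minor_cong) (auto simp: col_upd_def ft_def)
  also have "\<dots> = (\<Sum>i<m. y i * minor (col_upd ft m (\<lambda>c. ft c i)) C (insert m J))"
    using C finJ cardm by (intro minor_col_upd_linear) auto
  also have "\<dots> = (\<Sum>i\<in>{..<m} - J. y i * (-1) ^ card {r \<in> J. i < r} * minor ft C (insert i J))"
    unfolding minor_col_upd_copy[OF C J card] by (rule sum.mono_neutral_cong_right) auto
  also have "\<dots> = (\<Sum>i\<in>{..<m} - J. y i * (-1) ^ card {r \<in> J. i < r} * minor f (insert i J) C)"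
  proof (rule sum.cong[OF refl])
    fix i assume "i \<in> {..<m} - J"
    then have "card (insert i J) = card C" using finJ card by simp
    then show "y i * (-1) ^ card {r \<in> J. i < r} * minor ft C (insert i J) =
      y i * (-1) ^ card {r \<in> J. i < r} * minor f (insert i J) C"
      unfolding ft_def using minor_transpose[of "insert i J" C f] by simp
  qed
  finally show ?thesis .
qed

lemma row_combination_exists:
  fixes f :: "nat \<Rightarrow> nat \<Rightarrow> 'a::field"
  assumes "minor f {..<m} {..<m} \<noteq> 0"
  obtains y where "\<And>c. c < m \<Longrightarrow> v c = (\<Sum>i<m. y i * f i c)"
proof -
  define B where "B = mat m m (\<lambda>(r, c). f r c)"
  have B: "B \<in> carrier_mat m m" unfolding B_def by simp
  have "minor (ent B) {..<m} {..<m} = minor f {..<m} {..<m}" by (rule minor_cong) (auto simp: B_def)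
  then have "det B \<noteq> 0" using assms det_minor[OF B] by simp
  then obtain N where N: "N \<in> carrier_mat m m" "N * B = 1\<^sub>m m"
    using right_inverse_mat_exists[OF B] by blast
  have NB: "(\<Sum>i<m. N $$ (d, i) * f i c) = (if d = c then 1 else 0)" if "d < m" "c < m" for d c
  proof -
    have "(N * B) $$ (d, c) = (\<Sum>i<m. N $$ (d, i) * f i c)"
      using that B N(1) by (simp add: scalar_prod_def atLeast0LessThan B_def)
    moreover have "(N * B) $$ (d, c) = (if d = c then 1 else 0)" unfolding N(2) using that by simp
    ultimately show ?thesis by (rule trans[OF sym])
  qed
  have "v c = (\<Sum>i<m. (\<Sum>d<m. v d * N $$ (d, i)) * f i c)" if c: "c < m" for c
  proof -
    have "(\<Sum>i<m. (\<Sum>d<m. v d * N $$ (d, i)) * f i c) = (\<Sum>i<m. \<Sum>d<m. v d * (N $$ (d, i) * f i c))"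
      by (simp add: sum_distrib_right mult.assoc)
    also have "\<dots> = (\<Sum>d<m. v d * (\<Sum>i<m. N $$ (d, i) * f i c))"
      by (subst sum.swap) (simp add: sum_distrib_left)
    also have "\<dots> = (\<Sum>d<m. if d = c then v d else 0)"
      using c by (intro sum.cong) (auto simp: NB)
    also have "\<dots> = v c" using c by simp
    finally show ?thesis by simp
  qed
  then show thesis by (rule that)
qed

text \<open>Keeping the omitted row fixed while \<open>j\<close> grows makes ratios of two such
  coordinates comparable across dimensions.\<close>

definition omit_minor :: "(nat \<Rightarrow> nat \<Rightarrow> 'a::comm_ring_1) \<Rightarrow> nat \<Rightarrow> nat \<Rightarrow> 'a" where
  "omit_minor f j x = minor f ({..j} - {x}) {..<j}"

text \<open>On the first j + 1 columns, row j + 1 is a combination of the rows above with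
  coefficients \<open>y\<close>. Coordinates of size j + 1 are then single coefficients times
  \<open>minor f {..j} {..j}\<close> up to sign, the last coordinate of size j involves only
  \<open>y a\<close> and \<open>y b\<close>, and eliminating these gives the relation.\<close>

lemma three_term_Plucker:
  fixes f :: "nat \<Rightarrow> nat \<Rightarrow> 'a::field"
  assumes ab: "a < b" "b \<le> j" and Z: "minor f {..j} {..j} \<noteq> 0"
  shows "omit_minor f j a * omit_minor f (Suc j) b =
    omit_minor f j b * omit_minor f (Suc j) a + minor f {..j} {..j} * minor f (insert (Suc j) ({..j} - {a, b})) {..<j}"
proof -
  have Z': "minor f {..<Suc j} {..<Suc j} \<noteq> 0" using Z by (simp add: lessThan_Suc_atMost)
  obtain y where y: "\<And>c. c < Suc j \<Longrightarrow> f (Suc j) c = (\<Sum>i<Suc j. y i * f i c)"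
    by (rule row_combination_exists[OF Z', of "f (Suc j)"]) auto
  have omit: "omit_minor f (Suc j) i = y i * (-1) ^ (j - i) * minor f {..j} {..j}" if i: "i \<le> j" for i
  proof -
    have eq: "{..Suc j} - {i} = insert (Suc j) ({..j} - {i})" using i by (auto simp: atMost_Suc)
    have c: "{r \<in> {..j} - {i}. i < r} = {i<..j}" by auto
    have d: "{..<Suc j} - ({..j} - {i}) = {i}" "insert i ({..j} - {i}) = {..j}" using i by auto
    have "minor f (insert (Suc j) ({..j} - {i})) {..<Suc j} =
      (\<Sum>i'\<in>{..<Suc j} - ({..j} - {i}). y i' * (-1) ^ card {r \<in> {..j} - {i}. i' < r} * minor f (insert i' ({..j} - {i})) {..<Suc j})"
      using i y by (intro minor_row_combination) auto
    also have "\<dots> = y i * (-1) ^ (j - i) * minor f {..j} {..j}"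
      unfolding d(1) using d(2) c by (simp add: lessThan_Suc_atMost)
    finally show ?thesis unfolding omit_minor_def eq .
  qed
  define S where "S = {..j} - {a, b}"
  have S: "S \<subseteq> {..<Suc j}" "{..<Suc j} - S = {a, b}" "insert a S = {..j} - {b}" "insert b S = {..j} - {a}"
    "{r \<in> S. a < r} = {a<..j} - {b}" "{r \<in> S. b < r} = {b<..j}"
    unfolding S_def using ab by auto
  have cS: "card S = j - 1" unfolding S_def using ab by (simp add: card_Diff_subset)
  have "minor f (insert (Suc j) S) {..<j} =
    (\<Sum>i\<in>{..<Suc j} - S. y i * (-1) ^ card {r \<in> S. i < r} * minor f (insert i S) {..<j})"
    using y S(1) cS ab by (intro minor_row_combination) auto
  also have "\<dots> = y a * (-1) ^ (j - a - 1) * omit_minor f j b + y b * (-1) ^ (j - b) * omit_minor f j a"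
    unfolding S(2) omit_minor_def using ab by (simp add: S(3-6) card_Diff_subset)
  finally have R: "minor f (insert (Suc j) S) {..<j} =
    y a * (-1) ^ (j - a - 1) * omit_minor f j b + y b * (-1) ^ (j - b) * omit_minor f j a" .
  \<comment> \<open>Row \<open>a\<close> passes one row fewer because \<open>b\<close> is missing
    too; this one sign produces the plus in the relation.\<close>
  have "(-1 :: 'a) ^ (j - a) = - ((-1) ^ (j - a - 1))"
  proof -
    have "j - a = Suc (j - a - 1)" using ab by simp
    then show ?thesis by (metis mult_minus1 power_Suc)
  qed
  then show ?thesis unfolding omit[OF ab(2)] omit[OF order_trans[OF less_imp_le[OF ab(1)] ab(2)]] S_def[symmetric] R
    by (simp add: algebra_simps)
qed

text \<open>The intended inequality is p <= q. Another representative multiplies p and q by the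
  same, possibly negative, number; the extra factor p turns this into a square, so that the
  condition depends on the flag only.\<close>

definition gap_condition :: "nat \<Rightarrow> nat \<Rightarrow> real mat \<Rightarrow> bool" where
  "gap_condition k l g \<longleftrightarrow>
     (let p = omit_minor (ent g) k k * omit_minor (ent g) l (k - 1);
          q = omit_minor (ent g) k (k - 1) * omit_minor (ent g) l k
      in p * p \<le> p * q)"

text \<open>By the three-term relation the ratio of \<open>omit_minor (ent g) j (k - 1)\<close> to
  \<open>omit_minor (ent g) j k\<close> decreases in j. Comparing j = k with j = l eliminates the
  sizes in between.\<close>

lemma TP_imp_gap_condition:
  assumes tp: "TP n n (ent g)" and k: "1 \<le> k" "k \<le> l" "l < n"
  shows "gap_condition k l g"
proof -
  let ?O = "omit_minor (ent g)"
  have pos: "?O j x > 0" if "j < n" "x \<le> j" for j x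
    unfolding omit_minor_def using that by (intro TP_D[OF tp]) (auto simp: card_Diff_subset)
  have ineq: "?O j k * ?O (Suc j) (k - 1) \<le> ?O j (k - 1) * ?O (Suc j) k" if j: "k \<le> j" "Suc j < n" for j
  proof -
    have Z: "minor (ent g) {..j} {..j} > 0" using j by (intro TP_D[OF tp]) auto
    have S: "minor (ent g) (insert (Suc j) ({..j} - {k - 1, k})) {..<j} > 0"
      using j k by (intro TP_D[OF tp]) (auto simp: card_Diff_subset card_insert_if)
    have "?O j (k - 1) * ?O (Suc j) k = ?O j k * ?O (Suc j) (k - 1) +
      minor (ent g) {..j} {..j} * minor (ent g) (insert (Suc j) ({..j} - {k - 1, k})) {..<j}"
      using Z j k by (intro three_term_Plucker) auto
    then show ?thesis using mult_pos_pos[OF Z S] by simp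
  qed
  have "j < n \<Longrightarrow> ?O k k * ?O j (k - 1) \<le> ?O k (k - 1) * ?O j k" if "k \<le> j" for j
    using that
  proof (induction j rule: dec_induct)
    case base
    then show ?case by simp
  next
    case (step j)
    have p: "?O j k > 0" "?O (Suc j) k > 0" "?O k k > 0" using step k by (auto intro!: pos)
    have "?O j k * (?O k k * ?O (Suc j) (k - 1)) \<le> ?O k k * (?O j (k - 1) * ?O (Suc j) k)"
      using mult_left_mono[OF ineq[of j], of "?O k k"] step p by (simp add: mult_ac)
    also have "\<dots> = ?O (Suc j) k * (?O k k * ?O j (k - 1))" by simp
    also have "\<dots> \<le> ?O (Suc j) k * (?O k (k - 1) * ?O j k)"
      using step p by (intro mult_left_mono) auto
    finally have "?O j k * (?O k k * ?O (Suc j) (k - 1)) \<le> ?O j k * (?O k (k - 1) * ?O (Suc j) k)"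
      by (simp add: mult_ac)
    then show ?case using p by simp
  qed
  from this[OF k(2,3)] show ?thesis
    unfolding gap_condition_def Let_def using k by (intro mult_left_mono mult_nonneg_nonneg less_imp_le[OF pos]) auto
qed

lemma gap_condition_flag_of:
  assumes K: "K \<subseteq> {..n}" and kl: "k \<in> K" "l \<in> K" "1 \<le> k" "k \<le> l" "l < n"
    and gh: "g \<in> GL n" "h \<in> GL n" "flag_of K n g = flag_of K n h" and gap: "gap_condition k l g"
  shows "gap_condition k l h"
proof -
  have le: "k \<le> n" "l \<le> n" using kl by auto
  obtain d where d: "\<And>I. I \<subseteq> {..<n} \<Longrightarrow> card I = k \<Longrightarrow> minor (ent h) I {..<k} = minor (ent g) I {..<k} * d"
    by (rule flag_of_eq_imp_minor_mult[OF gh kl(1) le(1)]) auto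
  obtain e where e: "\<And>I. I \<subseteq> {..<n} \<Longrightarrow> card I = l \<Longrightarrow> minor (ent h) I {..<l} = minor (ent g) I {..<l} * e"
    by (rule flag_of_eq_imp_minor_mult[OF gh kl(2) le(2)]) auto
  have k': "omit_minor (ent h) k x = omit_minor (ent g) k x * d" if "x \<le> k" for x
    unfolding omit_minor_def using that kl by (intro d) (auto simp: card_Diff_subset)
  have l': "omit_minor (ent h) l x = omit_minor (ent g) l x * e" if "x \<le> l" for x
    unfolding omit_minor_def using that kl by (intro e) (auto simp: card_Diff_subset)
  define p where "p = omit_minor (ent g) k k * omit_minor (ent g) l (k - 1)"
  define q where "q = omit_minor (ent g) k (k - 1) * omit_minor (ent g) l k"
  have "p * p \<le> p * q" using gap unfolding gap_condition_def p_def q_def by (simp add: Let_def)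
  then have "(p * p) * (d * e)\<^sup>2 \<le> (p * q) * (d * e)\<^sup>2" by (intro mult_right_mono) auto
  moreover have "omit_minor (ent h) k k * omit_minor (ent h) l (k - 1) = p * (d * e)"
    "omit_minor (ent h) k (k - 1) * omit_minor (ent h) l k = q * (d * e)"
    using kl by (simp_all add: k' l' p_def q_def)
  ultimately show ?thesis unfolding gap_condition_def Let_def by (simp add: power2_eq_square mult_ac)
qed

lemma closedin_gap_condition:
  assumes kl: "1 \<le> k" "k \<le> l" "l < n"
  shows "closedin (GL_topology n) {g \<in> GL n. gap_condition k l g}"
proof -
  have O: "continuous_map (GL_topology n) euclideanreal (\<lambda>g. omit_minor (ent g) j x)" if "j < n" "x \<le> j" for j x
    unfolding omit_minor_def using that by (intro continuous_map_minor) (auto simp: card_Diff_subset)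
  define p where "p g = omit_minor (ent g) k k * omit_minor (ent g) l (k - 1)" for g :: "real mat"
  define q where "q g = omit_minor (ent g) k (k - 1) * omit_minor (ent g) l k" for g :: "real mat"
  have "continuous_map (GL_topology n) euclideanreal p" "continuous_map (GL_topology n) euclideanreal q"
    unfolding p_def q_def using kl by (auto intro!: continuous_map_real_mult O)
  then have "continuous_map (GL_topology n) euclideanreal (\<lambda>g. p g * q g - p g * p g)"
    by (intro continuous_map_diff continuous_map_real_mult)
  from closedin_continuous_map_preimage[OF this, of "{0..}"]
  show ?thesis unfolding gap_condition_def p_def q_def Let_def by simp
qed

text \<open>The columns are \<open>e\<^sub>0, \<dots>, e\<^sub>k\<^sub>-\<^sub>2, e\<^sub>k\<^sub>-\<^sub>1 + e\<^sub>k\<^sub>+\<^sub>2, e\<^sub>k, e\<^sub>k\<^sub>+\<^sub>1, e\<^sub>k\<^sub>+\<^sub>3, \<dots>, e\<^sub>l, e\<^sub>k\<^sub>+\<^sub>2, e\<^sub>l\<^sub>+\<^sub>1, \<dots>\<close>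
  (indexed from \<open>0\<close>), where \<open>l \<ge> k + 2\<close>.\<close>

definition gap_perm :: "nat \<Rightarrow> nat \<Rightarrow> nat \<Rightarrow> nat" where
  "gap_perm k l c = (if c = l then k + 2 else if k + 2 \<le> c \<and> c < l then Suc c else c)"

definition gap_entry :: "nat \<Rightarrow> nat \<Rightarrow> nat \<Rightarrow> nat \<Rightarrow> real" where
  "gap_entry k l i c = (if i = gap_perm k l c \<or> (c = k - 1 \<and> i = k + 2) then 1 else 0)"

lemma pos_lessThan: "i \<le> n \<Longrightarrow> pos {..<n} i = i"
proof -
  assume "i \<le> n"
  then have "{a \<in> {..<n}. a < i} = {..<i}" by auto
  then show ?thesis unfolding pos_def by simp
qed

lemma pos_lessThan_remove: "x < n \<Longrightarrow> i \<le> n \<Longrightarrow> pos ({..<n} - {x}) i = (if x < i then i - 1 else i)"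
  using pos_remove[of "{..<n}" x i] pos_lessThan[of i n] by simp

section \<open>A Plucker-nonnegative flag violating the inequality\<close>

context
  fixes k l n :: nat
  assumes kl: "1 \<le> k" "k + 2 \<le> l" "l < n"
begin

text \<open>Column \<open>l\<close> is the unit vector of row k + 2, the row that also holds the
  extra entry. Deleting both leaves an identity matrix.\<close>

lemma gap_entry_det: "minor (gap_entry k l) {..<n} {..<n} \<noteq> 0"
proof -
  have "minor (gap_entry k l) {..<n} {..<n} = (\<Sum>i<n. (-1) ^ (pos {..<n} i + pos {..<n} l) * gap_entry k l i l *
      minor (gap_entry k l) ({..<n} - {i}) ({..<n} - {l}))"
    by (rule minor_expand_col) (use kl in auto)
  also have "\<dots> = (\<Sum>i<n. if i = k + 2 then (-1) ^ (pos {..<n} (k + 2) + pos {..<n} l) *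
      minor (gap_entry k l) ({..<n} - {k + 2}) ({..<n} - {l}) else 0)"
    by (rule sum.cong) (use kl in \<open>auto simp: gap_entry_def gap_perm_def\<close>)
  also have "\<dots> = (-1) ^ (pos {..<n} (k + 2) + pos {..<n} l) *
      minor (gap_entry k l) ({..<n} - {k + 2}) ({..<n} - {l})"
    using kl by simp
  also have "minor (gap_entry k l) ({..<n} - {k + 2}) ({..<n} - {l}) = 1"
  proof (rule minor_one)
    show "card ({..<n} - {k + 2}) = card ({..<n} - {l})" using kl by simp
    fix i j assume "i \<in> {..<n} - {k + 2}" "j \<in> {..<n} - {l}"
    then have "i < n" "i \<noteq> k + 2" "j < n" "j \<noteq> l" by auto
    then show "gap_entry k l i j = (if pos ({..<n} - {k + 2}) i = pos ({..<n} - {l}) j then 1 else 0)"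
      using kl by (auto simp: pos_lessThan_remove gap_entry_def gap_perm_def)
  qed
  finally show ?thesis by simp
qed

lemma gap_entry_k_1: "minor (gap_entry k l) {..<k} {..<k} = 1"
proof (rule minor_one)
  fix i j assume "i \<in> {..<k}" "j \<in> {..<k}"
  then show "gap_entry k l i j = (if pos {..<k} i = pos {..<k} j then 1 else 0)"
    using kl by (auto simp: pos_lessThan gap_entry_def gap_perm_def)
qed simp

lemma gap_entry_k_2: "minor (gap_entry k l) (insert (k + 2) {..<k - 1}) {..<k} = 1"
proof (rule minor_one)
  show "card (insert (k + 2) {..<k - 1}) = card {..<k}" using kl by simp
  fix i j assume ij: "i \<in> insert (k + 2) {..<k - 1}" "j \<in> {..<k}"
  have "pos (insert (k + 2) {..<k - 1}) i = (if i = k + 2 then k - 1 else i)"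
  proof -
    have "{a \<in> insert (k + 2) {..<k - 1}. a < i} = (if i = k + 2 then {..<k - 1} else {..<i})" using ij by auto
    then show ?thesis unfolding pos_def by simp
  qed
  then show "gap_entry k l i j = (if pos (insert (k + 2) {..<k - 1}) i = pos {..<k} j then 1 else 0)"
    using kl ij by (auto simp: pos_lessThan gap_entry_def gap_perm_def)
qed

text \<open>The unit vectors among the first k columns force rows 0 to k - 2; the remaining column
  admits row k - 1 or k + 2, and either one comes last in the selection.\<close>

lemma gap_entry_k_minor:
  assumes I: "I \<subseteq> {..<n}" "card I = k"
  shows "minor (gap_entry k l) I {..<k} \<in> {0, 1}"
proof (rule ccontr)
  assume *: "minor (gap_entry k l) I {..<k} \<notin> {0, 1}"
  have fin: "finite I" using I finite_subset by auto
  have rows: "i < k \<or> i = k + 2" if "i \<in> I" for i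
  proof (rule ccontr)
    assume i: "\<not> (i < k \<or> i = k + 2)"
    have "minor (gap_entry k l) I {..<k} = 0"
      by (rule minor_zero_row[of _ _ i]) (use fin I that i kl in \<open>auto simp: gap_entry_def gap_perm_def\<close>)
    then show False using * by simp
  qed
  have sub: "{..<k - 1} \<subseteq> I"
  proof (rule ccontr)
    assume "\<not> {..<k - 1} \<subseteq> I"
    then obtain c where c: "c < k - 1" "c \<notin> I" by auto
    have "minor (gap_entry k l) I {..<k} = 0"
      by (rule minor_zero_col[of _ _ c]) (use fin I c kl in \<open>auto simp: gap_entry_def gap_perm_def\<close>)
    then show False using * by simp
  qed
  show False
  proof (cases "k + 2 \<in> I")
    case True
    have "insert (k + 2) {..<k - 1} = I"
      by (rule card_subset_eq) (use fin True sub I kl in auto)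
    then show False using * gap_entry_k_2 by simp
  next
    case False
    then have "I \<subseteq> {..<k}" using rows by auto
    then have "I = {..<k}" using I by (intro card_subset_eq) auto
    then show False using * gap_entry_k_1 by simp
  qed
qed

lemma gap_entry_l_1: "minor (gap_entry k l) ({..l} - {k + 2}) {..<l} = 1"
proof (rule minor_one)
  show "card ({..l} - {k + 2}) = card {..<l}" using kl by simp
  fix i j assume "i \<in> {..l} - {k + 2}" "j \<in> {..<l}"
  then have "i \<le> l" "i \<noteq> k + 2" "j < l" by auto
  then show "gap_entry k l i j = (if pos ({..l} - {k + 2}) i = pos {..<l} j then 1 else 0)"
    unfolding lessThan_Suc_atMost[symmetric]
    using kl by (auto simp: pos_lessThan pos_lessThan_remove gap_entry_def gap_perm_def)
qed

text \<open>Rows k - 1 and k + 2 coincide on the first l columns, and exactly two rows lie between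
  them. Exchanging one for the other shifts the rank by 2 and keeps the sign; with k + 1 in place of
  k + 2 the sign would flip.\<close>

lemma gap_entry_l_2: "minor (gap_entry k l) ({..l} - {k - 1}) {..<l} = 1"
proof -
  have "minor (gap_entry k l) ({..l} - {k - 1}) {..<l} = minor (gap_entry k l) ({..l} - {k + 2}) {..<l}"
  proof (rule minor_move_row[of _ _ "k + 2" _ "k - 1"])
    have "pos ({..l} - {k - 1}) (k + 2) = k + 1" "pos ({..l} - {k + 2}) (k - 1) = k - 1"
      unfolding lessThan_Suc_atMost[symmetric] using kl by (simp_all add: pos_lessThan_remove)
    then show "even (pos ({..l} - {k - 1}) (k + 2)) = even (pos ({..l} - {k + 2}) (k - 1))" using kl by simp
    fix j assume "j \<in> {..<l}"
    then show "gap_entry k l (k + 2) j = gap_entry k l (k - 1) j"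
      using kl by (auto simp: gap_entry_def gap_perm_def)
  qed (use kl in auto)
  then show ?thesis using gap_entry_l_1 by simp
qed

lemma gap_entry_l_minor:
  assumes I: "I \<subseteq> {..<n}" "card I = l"
  shows "minor (gap_entry k l) I {..<l} \<in> {0, 1}"
proof (rule ccontr)
  assume *: "minor (gap_entry k l) I {..<l} \<notin> {0, 1}"
  have fin: "finite I" using I finite_subset by auto
  have rows: "i \<le> l" if "i \<in> I" for i
  proof (rule ccontr)
    assume i: "\<not> i \<le> l"
    have "minor (gap_entry k l) I {..<l} = 0"
      by (rule minor_zero_row[of _ _ i]) (use fin I that i kl in \<open>auto simp: gap_entry_def gap_perm_def\<close>)
    then show False using * by simp
  qed
  then have sub: "I \<subseteq> {..l}" by auto
  have "I \<noteq> {..l}"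
  proof
    assume "I = {..l}"
    then have "card I = Suc l" by simp
    then show False using I by simp
  qed
  then obtain x where x: "x \<le> l" "x \<notin> I" using sub by auto
  have "I \<subseteq> {..l} - {x}" using sub x by auto
  then have Ix: "I = {..l} - {x}" using I x by (intro card_subset_eq) (auto simp: card_Diff_subset)
  show False
  proof (cases "x = k - 1 \<or> x = k + 2")
    case True
    then show False using * gap_entry_l_1 gap_entry_l_2 unfolding Ix by auto
  next
    case False
    \<comment> \<open>This inverts \<open>gap_perm\<close>: column \<open>c\<close> has its only
      entry in row \<open>x\<close>, so omitting that row makes the column zero.\<close>
    define c where "c = (if x < k + 2 then x else x - 1)"
    have c: "c < l" "c \<noteq> k - 1" "gap_perm k l c = x"
      unfolding c_def gap_perm_def using False x(1) kl by auto
    have "minor (gap_entry k l) I {..<l} = 0"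
      by (rule minor_zero_col[of _ _ c]) (use fin I c x in \<open>auto simp: gap_entry_def\<close>)
    then show False using * by simp
  qed
qed

text \<open>For these j the first j columns are supported in the first j rows, so at most one
  coordinate is nonzero. Its sign can stay open, as a single nonzero coordinate is always sign
  coherent.\<close>

lemma gap_entry_other_minor:
  assumes j: "j < k \<or> l < j" and I: "finite I" "card I = j"
  shows "minor (gap_entry k l) I {..<j} \<in> {0, minor (gap_entry k l) {..<j} {..<j}}"
proof (rule ccontr)
  assume *: "minor (gap_entry k l) I {..<j} \<notin> {0, minor (gap_entry k l) {..<j} {..<j}}"
  have "i < j" if "i \<in> I" for i
  proof (rule ccontr)
    assume i: "\<not> i < j"
    have "minor (gap_entry k l) I {..<j} = 0"
      by (rule minor_zero_row[of _ _ i]) (use I that i kl j in \<open>auto simp: gap_entry_def gap_perm_def\<close>)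
    then show False using * by simp
  qed
  then have "I \<subseteq> {..<j}" by auto
  then have "I = {..<j}" using I by (intro card_subset_eq) auto
  then show False using * by simp
qed

definition gap_mat :: "real mat" where
  "gap_mat = mat n n (\<lambda>(i, j). gap_entry k l i j)"

lemma minor_gap_mat:
  assumes "I \<subseteq> {..<n}" "J \<subseteq> {..<n}"
  shows "minor (ent gap_mat) I J = minor (gap_entry k l) I J"
proof (rule minor_cong)
  show "finite I" "finite J" using assms by (meson finite_subset finite_lessThan)+
qed (use assms in \<open>simp add: gap_mat_def subset_iff\<close>)

lemma gap_mat_GL: "gap_mat \<in> GL n"
  unfolding GL_iff_minor using minor_gap_mat[of "{..<n}" "{..<n}"] gap_entry_det by (simp add: gap_mat_def)

lemma sign_coherent_gap_mat:
  assumes K: "K \<subseteq> {..n}" and gap: "\<And>j. j \<in> K \<Longrightarrow> j \<le> k \<or> l \<le> j"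
  shows "sign_coherent K n gap_mat"
proof -
  have *: "\<exists>v. \<forall>I. I \<subseteq> {..<n} \<longrightarrow> card I = j \<longrightarrow> minor (ent gap_mat) I {..<j} \<in> {0, v}" if j: "j \<in> K" for j
  proof -
    have sub: "{..<j} \<subseteq> {..<n}" using j K by auto
    consider "j = k" | "j = l" | "j < k \<or> l < j" using gap[OF j] by linarith
    then show ?thesis
    proof cases
      case 1
      then show ?thesis using gap_entry_k_minor minor_gap_mat[OF _ sub] by (intro exI[of _ 1]) auto
    next
      case 2
      then show ?thesis using gap_entry_l_minor minor_gap_mat[OF _ sub] by (intro exI[of _ 1]) auto
    next
      case 3
      then show ?thesis using gap_entry_other_minor[OF 3] minor_gap_mat[OF _ sub] finite_subset[OF _ finite_lessThan[of n]]
        by (intro exI[of _ "minor (gap_entry k l) {..<j} {..<j}"]) auto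
    qed
  qed
  show ?thesis unfolding sign_coherent_def
  proof (intro ballI allI impI)
    fix j I J assume j: "j \<in> K" and IJ: "I \<subseteq> {..<n}" "J \<subseteq> {..<n}" "card I = j" "card J = j"
    obtain v where v: "\<forall>I. I \<subseteq> {..<n} \<longrightarrow> card I = j \<longrightarrow> minor (ent gap_mat) I {..<j} \<in> {0, v}"
      using *[OF j] by blast
    have "minor (ent gap_mat) I {..<j} \<in> {0, v}" "minor (ent gap_mat) J {..<j} \<in> {0, v}" using v IJ by blast+
    then show "0 \<le> minor (ent gap_mat) I {..<j} * minor (ent gap_mat) J {..<j}" by auto
  qed
qed

text \<open>Row k vanishes on the first k columns, so
  \<open>omit_minor (ent gap_mat) k (k - 1)\<close> is 0 and the condition would read 1 <=
  0.\<close>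

lemma not_gap_condition_gap_mat: "\<not> gap_condition k l gap_mat"
proof -
  have "omit_minor (ent gap_mat) k k = minor (gap_entry k l) {..<k} {..<k}"
  proof -
    have "{..k} - {k} = {..<k}" by auto
    then show ?thesis unfolding omit_minor_def using kl by (subst minor_gap_mat) auto
  qed
  moreover have "omit_minor (ent gap_mat) l (k - 1) = minor (gap_entry k l) ({..l} - {k - 1}) {..<l}"
    unfolding omit_minor_def using kl by (intro minor_gap_mat) auto
  moreover have "omit_minor (ent gap_mat) k (k - 1) = 0"
  proof -
    have "omit_minor (ent gap_mat) k (k - 1) = minor (gap_entry k l) ({..k} - {k - 1}) {..<k}"
      unfolding omit_minor_def using kl by (intro minor_gap_mat) auto
    also have "\<dots> = 0"
      by (rule minor_zero_row[of _ _ k]) (use kl in \<open>auto simp: gap_entry_def gap_perm_def\<close>)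
    finally show ?thesis .
  qed
  ultimately show ?thesis unfolding gap_condition_def Let_def using gap_entry_k_1 gap_entry_l_2 by simp
qed

end

text \<open>Some integer between the minimum and the maximum is missing; its nearest neighbours in
  \<open>K\<close> on both sides bound the gap.\<close>

lemma not_consecutive_gap:
  assumes "finite K" "\<not> consecutive K"
  obtains k l where "k \<in> K" "l \<in> K" "k + 2 \<le> l" "\<And>j. j \<in> K \<Longrightarrow> j \<le> k \<or> l \<le> j"
proof -
  have "K \<noteq> {}"
  proof
    assume "K = {}"
    then have "K = {1..0}" by simp
    then show False using assms(2) unfolding consecutive_def by blast
  qed
  have "K \<noteq> {Min K..Max K}" using assms(2) unfolding consecutive_def by blast
  moreover have "K \<subseteq> {Min K..Max K}" using assms(1) by auto
  ultimately obtain m where "m \<in> {Min K..Max K}" "m \<notin> K" by blast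
  then have m: "Min K \<le> m" "m \<le> Max K" "m \<notin> K" by auto
  have mM: "Min K \<in> K" "Max K \<in> K" using assms(1) \<open>K \<noteq> {}\<close> by auto
  define A where "A = {x \<in> K. x < m}"
  define B where "B = {x \<in> K. m < x}"
  have "Min K \<in> A" "Max K \<in> B" using mM m unfolding A_def B_def by (auto simp: order_less_le)
  then have ne: "A \<noteq> {}" "B \<noteq> {}" by auto
  have fin: "finite A" "finite B" using assms(1) unfolding A_def B_def by auto
  have k: "Max A \<in> A" and l: "Min B \<in> B" using fin ne by auto
  have "j \<le> Max A \<or> Min B \<le> j" if "j \<in> K" for j
  proof -
    have "j \<in> A \<or> j \<in> B" using that m(3) unfolding A_def B_def by (cases j m rule: linorder_cases) auto
    then show ?thesis using fin by auto
  qed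
  moreover have "Max A + 2 \<le> Min B" using k l unfolding A_def B_def by auto
  ultimately show thesis using that[of "Max A" "Min B"] k l unfolding A_def B_def by auto
qed

section \<open>The equivalence\<close>

lemma Fl_Plucker_pos_subset_nonneg: "Fl_Plucker_pos K n \<subseteq> Fl_Plucker_nonneg K n"
  unfolding Fl_Plucker_pos_def Fl_Plucker_nonneg_def by (blast intro: less_imp_le)

lemma Fl_Plucker_nonneg_eq_closure:
  assumes K: "K \<subseteq> {1..n}"
  shows "Fl_Plucker_nonneg K n = flag_topology K n closure_of Fl_Plucker_pos K n"
proof
  have K': "K \<subseteq> {..n}" using K by auto
  show "flag_topology K n closure_of Fl_Plucker_pos K n \<subseteq> Fl_Plucker_nonneg K n"
    by (rule closure_of_minimal[OF Fl_Plucker_pos_subset_nonneg closedin_Fl_Plucker_nonneg[OF K]])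
  show "Fl_Plucker_nonneg K n \<subseteq> flag_topology K n closure_of Fl_Plucker_pos K n"
  proof
    fix V assume V: "V \<in> Fl_Plucker_nonneg K n"
    obtain g where g: "g \<in> GL n" "flag_of K n g = V"
      "\<And>k I. k \<in> K \<Longrightarrow> I \<subseteq> {..<n} \<Longrightarrow> card I = k \<Longrightarrow> minor (ent g) I {..<k} \<ge> 0"
      by (rule Fl_Plucker_nonnegE[OF K' V]) auto
    have "V \<in> topspace (flag_topology K n)"
      using V unfolding topspace_flag_topology[OF K'] Fl_Plucker_nonneg_def by blast
    moreover have "\<exists>W. W \<in> Fl_Plucker_pos K n \<and> W \<in> U" if U: "V \<in> U" "openin (flag_topology K n) U" for U
    proof -
      obtain h where h: "h \<in> GL n" "flag_of K n h \<in> U" "\<forall>k\<in>K. max_minors_pos n k (ent h)"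
        using flag_neighbourhood_Plucker_pos[OF K' U(2) g(1) _ g(3)] U(1) g(2) by blast
      have hF: "flag_of K n h \<in> flags K n" by (rule flag_of_in_flags[OF h(1) K'])
      have "represents K n h (flag_of K n h)"
        using represents_GL_iff[OF h(1) K', of "flag_of K n h"] unfolding flag_of_def by simp
      moreover have "det (submatrix h I {..<k}) > 0" if k: "k \<in> K" and I: "I \<subseteq> {..<n}" "card I = k" for k I
      proof -
        have "{..<k} \<subseteq> {..<n}" using k K by auto
        then show ?thesis
          using h(1,3) k I det_submatrix[of I h "{..<k}"] unfolding max_minors_pos_def GL_def by auto
      qed
      ultimately have "flag_of K n h \<in> Fl_Plucker_pos K n" unfolding Fl_Plucker_pos_def using hF by blast
      then show ?thesis using h(2) by blast
    qed
    ultimately show "V \<in> flag_topology K n closure_of Fl_Plucker_pos K n" unfolding in_closure_of by blast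
  qed
qed

lemma not_consecutive_imp_neq:
  assumes K: "K \<subseteq> {1..n - 1}" and "\<not> consecutive K"
  shows "Fl_nonneg K n \<noteq> Fl_Plucker_nonneg K n"
proof
  assume eq: "Fl_nonneg K n = Fl_Plucker_nonneg K n"
  have K1: "K \<subseteq> {1..n}" by (rule subset_trans[OF K]) auto
  then have K': "K \<subseteq> {..n}" by auto
  have "finite K" using K finite_subset by auto
  then obtain k l where kl: "k \<in> K" "l \<in> K" "k + 2 \<le> l" and gap: "\<And>j. j \<in> K \<Longrightarrow> j \<le> k \<or> l \<le> j"
    by (rule not_consecutive_gap[OF _ assms(2)]) auto
  have "k \<in> {1..n - 1}" "l \<in> {1..n - 1}" using kl K by auto
  then have bd: "1 \<le> k" "k \<le> l" "l < n" using kl by auto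
  \<comment> \<open>\<open>C\<close> is closed and contains the totally positive flags, hence their
    closure, but not the flag of \<open>gap_mat\<close>.\<close>
  define C where "C = {V \<in> flags K n. \<exists>g\<in>GL n. flag_of K n g = V \<and> gap_condition k l g}"
  have "closedin (flag_topology K n) C" unfolding C_def
    by (rule closedin_flag_topologyI[OF K' gap_condition_flag_of[OF K' kl(1,2) bd] closedin_gap_condition[OF bd]])
  moreover have "Fl_pos K n \<subseteq> C"
  proof
    fix V assume "V \<in> Fl_pos K n"
    then obtain g where V: "V \<in> flags K n" and g: "g \<in> GL_pos n" "represents K n g V"
      unfolding Fl_pos_def by blast
    have gGL: "g \<in> GL n" using g(1) unfolding GL_pos_def by simp
    have "V \<in> extensional K" using V unfolding flags_def by blast
    then have "flag_of K n g = V" using represents_GL_iff[OF gGL K'] g(2) by blast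
    moreover have "gap_condition k l g" by (rule TP_imp_gap_condition[OF GL_pos_imp_TP[OF g(1)] bd])
    ultimately show "V \<in> C" unfolding C_def using V gGL by blast
  qed
  ultimately have "Fl_nonneg K n \<subseteq> C" unfolding Fl_nonneg_def by (rule closure_of_minimal[rotated])
  moreover have "flag_of K n (gap_mat k l n) \<in> Fl_Plucker_nonneg K n"
    by (intro sign_coherent_imp_Plucker_nonneg[OF K1] gap_mat_GL sign_coherent_gap_mat K' gap bd kl(3))
  ultimately have "flag_of K n (gap_mat k l n) \<in> C" using eq by blast
  then obtain g where g: "g \<in> GL n" "flag_of K n g = flag_of K n (gap_mat k l n)" "gap_condition k l g"
    unfolding C_def by blast
  then have "gap_condition k l (gap_mat k l n)"
    using gap_condition_flag_of[OF K' kl(1,2) bd g(1) _ g(2,3)] gap_mat_GL[OF bd(1) kl(3) bd(3)] by blast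
  then show False using not_gap_condition_gap_mat[OF bd(1) kl(3) bd(3)] by blast
qed

theorem theorem1p1:
  fixes n :: nat and K :: "nat set"
  assumes "K \<subseteq> {1..n - 1}"
  shows "(Fl_pos K n = Fl_Plucker_pos K n \<longleftrightarrow> Fl_nonneg K n = Fl_Plucker_nonneg K n) \<and>
         (Fl_nonneg K n = Fl_Plucker_nonneg K n \<longleftrightarrow> consecutive K)"
proof -
  have K1: "K \<subseteq> {1..n}" by (rule subset_trans[OF assms]) auto
  then have K': "K \<subseteq> {..n}" by auto
  have "Fl_nonneg K n = Fl_Plucker_nonneg K n" if "Fl_pos K n = Fl_Plucker_pos K n"
    unfolding Fl_nonneg_def that Fl_Plucker_nonneg_eq_closure[OF K1] ..
  moreover have "Fl_pos K n = Fl_Plucker_pos K n" if cons: "consecutive K"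
  proof -
    obtain a b where K: "K = {a..b}" using cons unfolding consecutive_def by blast
    \<comment> \<open>For empty \<open>K\<close> the given bounds are arbitrary and may be out of
      range, so \<open>{1..0}\<close> replaces them.\<close>
    obtain a' b' where "K = {a'..b'}" "1 \<le> a'" "b' \<le> n"
    proof (cases "K = {}")
      case True
      then show ?thesis using that[of 1 0] by simp
    next
      case False
      then have "a \<in> K" "b \<in> K" using K by auto
      then have "1 \<le> a" "b \<le> n" using K1 by auto
      then show ?thesis using that[of a b] K by simp
    qed
    then have "Fl_Plucker_pos K n \<subseteq> Fl_pos K n" by (rule Fl_Plucker_pos_subset_Fl_pos)
    then show ?thesis using Fl_pos_subset_Fl_Plucker_pos[OF K'] by blast
  qed
  moreover have "consecutive K" if "Fl_nonneg K n = Fl_Plucker_nonneg K n"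
    using not_consecutive_imp_neq[OF assms] that by blast
  ultimately show ?thesis by blast
qed

end
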